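(* Let $p$ be a prime, $s\in\mathbb{N}$ with $s\geq1$, $\mathcal{A}=(\mathbb{Z}/p\mathbb{Z})^s$, and let $\mu$ be a Borel probability measure on $\mathcal{A}^{\mathbb{Z}}$. Let $\Phi=1+\sigma$ on $\mathcal{A}^{\mathbb{Z}}$. Then $\Phi$ asymptotically randomizes $\mu$ if and only if $\mu$ is Lucas mixing.
   Context: $\sigma$ is the shift on $\mathcal{A}^{\mathbb{Z}}$ and $(1+\sigma)(\mathbf{a})=\mathbf{a}+\sigma(\mathbf{a})$, i.e. $\Phi(\mathbf{a})_m=a_m+a_{m+1}$. A set $\mathbb{J}\subset\mathbb{N}$ has Cesàro density one if $\lim_{N\to\infty}\frac1N\#(\mathbb{J}\cap[0,N))=1$. $\Phi$ asymptotically randomizes $\mu$ if there is $\mathbb{J}\subset\mathbb{N}$ of Cesàro density one such that the pushforwards $\Phi^j\mu$ converge weak* to the uniform Bernoulli (Haar) measure on $\mathcal{A}^{\mathbb{Z}}$ as $j\to\infty$ in $\mathbb{J}$. A character of $\mathcal{A}^{\mathbb{Z}}$ is a continuous homomorphism into the circle group; each has the form $\boldsymbol\chi(\mathbf{a})=\prod_{k\in\mathbb{K}}\chi_k(a_k)$ with $\mathbb{K}\subset\mathbb{Z}$ finite and each $\chi_k$ a nontrivial character of $\mathcal{A}$. For nontrivial $\boldsymbol\chi$ put $|[\boldsymbol\chi]|=\max(\mathbb{K})-\min(\mathbb{K})$ and $\langle\langle\boldsymbol\chi\rangle\rangle=p^r$ with $r=\lceil\log_p|[\boldsymbol\chi]|\rceil$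 (and $\langle\langle\boldsymbol\chi\rangle\rangle=1$ if $|[\boldsymbol\chi]|=0$). $\mu$ is Lucas mixing if for every nontrivial character $\boldsymbol\chi$ of $\mathcal{A}^{\mathbb{Z}}$ there is a subset $\mathbb{H}\subset\mathbb{N}$ of Cesàro density one such that $\lim_{\mathbb{H}\ni h\to\infty}\int\boldsymbol\chi\circ\Phi^{h\cdot\langle\langle\boldsymbol\chi\rangle\rangle}\,d\mu=0$. *)

theory Defs
  imports
    "HOL-Probability.Probability"
    "HOL-Library.Function_Algebras"
    "Berlekamp_Zassenhaus.Finite_Field"
begin

instantiation mod_ring :: (finite) discrete_topology
begin

definition open_mod_ring :: "'a mod_ring set \<Rightarrow> bool" where
  "open_mod_ring S \<longleftrightarrow> True"

instance
  by intro_classes (simp_all add: open_mod_ring_def)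

end

text \<open>
  Configurations over an alphabet \<open>'a\<close> are functions of type \<open>int \<Rightarrow> 'a\<close>. Such a function type
  carries the product topology (\<open>Function_Topology\<close>), the Borel sigma-algebra \<open>borel\<close> of that
  topology, and the pointwise group structure (\<open>Function_Algebras\<close>). The alphabet of the theorem
  is \<open>'p mod_ring ^ 's\<close>, where \<open>'p :: prime_card\<close> has a prime number of elements.
\<close>

definition shift :: "(int \<Rightarrow> 'a) \<Rightarrow> int \<Rightarrow> 'a" where
  "shift a = (\<lambda>m. a (m + 1))"

definition one_plus_shift :: "(int \<Rightarrow> 'a::plus) \<Rightarrow> int \<Rightarrow> 'a" where
  "one_plus_shift a = a + shift a"

definition cesaro_density_one :: "nat set \<Rightarrow> bool" where
  "cesaro_density_one J \<longleftrightarrow> (\<lambda>N. real (card (J \<inter> {0..<N})) / real N) \<longlonglongrightarrow> 1"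

text \<open>The filter of \<open>j \<rightarrow> \<infinity>\<close> with \<open>j\<close> ranging over \<open>J\<close> only.\<close>

definition sequentially_in :: "nat set \<Rightarrow> nat filter" where
  "sequentially_in J = inf sequentially (principal J)"

definition uniform_bernoulli :: "(int \<Rightarrow> 'a::finite) measure" where
  "uniform_bernoulli = (\<Pi>\<^sub>M m\<in>UNIV. uniform_count_measure (UNIV :: 'a set))"

text \<open>
  Weak* convergence, used below on compact configuration spaces only, where every continuous
  function is bounded.
\<close>

definition weak_star_tendsto ::
    "('i \<Rightarrow> 'x::topological_space measure) \<Rightarrow> 'x measure \<Rightarrow> 'i filter \<Rightarrow> bool" where
  "weak_star_tendsto \<nu> \<eta> F \<longleftrightarrow>
    (\<forall>f :: 'x \<Rightarrow> complex. continuous_on UNIV f \<longrightarrow>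
      ((\<lambda>i. integral\<^sup>L (\<nu> i) f) \<longlongrightarrow> integral\<^sup>L \<eta> f) F)"

definition asymptotically_randomizes ::
    "((int \<Rightarrow> 'a::{finite, topological_space}) \<Rightarrow> int \<Rightarrow> 'a) \<Rightarrow> (int \<Rightarrow> 'a) measure \<Rightarrow> bool" where
  "asymptotically_randomizes \<Phi> \<mu> \<longleftrightarrow>
    (\<exists>J. cesaro_density_one J \<and>
      weak_star_tendsto (\<lambda>j. distr \<mu> borel (\<Phi> ^^ j)) uniform_bernoulli (sequentially_in J))"

definition is_character :: "('g::{topological_space, ab_group_add} \<Rightarrow> complex) \<Rightarrow> bool" where
  "is_character \<psi> \<longleftrightarrow>
    continuous_on UNIV \<psi> \<and> (\<forall>x. norm (\<psi> x) = 1) \<and> (\<forall>x y. \<psi> (x + y) = \<psi> x * \<psi> y)"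

definition is_nontrivial_character ::
    "('g::{topological_space, ab_group_add} \<Rightarrow> complex) \<Rightarrow> bool" where
  "is_nontrivial_character \<psi> \<longleftrightarrow> is_character \<psi> \<and> (\<exists>x. \<psi> x \<noteq> 1)"

definition has_factorization ::
    "((int \<Rightarrow> 'a::{topological_space, ab_group_add}) \<Rightarrow> complex) \<Rightarrow>
      int set \<Rightarrow> (int \<Rightarrow> 'a \<Rightarrow> complex) \<Rightarrow> bool" where
  "has_factorization \<psi> K c \<longleftrightarrow>
    finite K \<and> (\<forall>k\<in>K. is_nontrivial_character (c k)) \<and> (\<forall>a. \<psi> a = (\<Prod>k\<in>K. c k (a k)))"

lemma has_factorization_unique:
  assumes "has_factorization \<psi> K c" "has_factorization \<psi> K' c'"
  shows "K = K'"
proof -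
  have *: "L \<subseteq> L'" if L: "has_factorization \<psi> L d" and L': "has_factorization \<psi> L' d'" for L L' d d'
  proof
    fix k assume k: "k \<in> L"
    have d0: "d j 0 = 1" if "has_factorization \<psi> M d" "j \<in> M" for M d and j :: int
    proof -
      have "is_character (d j)"
        using that by (auto simp: has_factorization_def is_nontrivial_character_def)
      hence "d j (0 + 0) = d j 0 * d j 0" and "norm (d j 0) = 1"
        unfolding is_character_def by blast+
      hence "d j 0 = d j 0 * d j 0" and "d j 0 \<noteq> 0" by auto
      thus ?thesis by auto
    qed
    obtain x where x: "d k x \<noteq> 1"
      using L k by (auto simp: has_factorization_def is_nontrivial_character_def)
    let ?a = "\<lambda>m. if m = k then x else 0"
    have "\<psi> ?a = (\<Prod>j\<in>L. d j (?a j))"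
      using L by (simp add: has_factorization_def)
    also have "\<dots> = (\<Prod>j\<in>L. if j = k then d k x else 1)"
      by (rule prod.cong) (auto simp: d0[OF L])
    also have "\<dots> = d k x"
      using L k by (simp add: has_factorization_def)
    finally have "\<psi> ?a \<noteq> 1" using x by simp
    moreover have "\<psi> ?a = 1" if "k \<notin> L'"
    proof -
      have "\<psi> ?a = (\<Prod>j\<in>L'. d' j (?a j))"
        using L' by (simp add: has_factorization_def)
      also have "\<dots> = 1"
        using that by (intro prod.neutral) (auto simp: d0[OF L'])
      finally show ?thesis .
    qed
    ultimately show "k \<in> L'" by blast
  qed
  show ?thesis using *[OF assms] *[OF assms(2,1)] by blast
qed

text \<open>
  The finite set of coordinates on which a character depends: the index set of its factorization
  into nontrivial characters of the alphabet. It is unique by the lemma above; every character of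
  the configuration space over a finite discrete alphabet has such a factorization by continuity.
\<close>

definition char_support ::
    "((int \<Rightarrow> 'a::{topological_space, ab_group_add}) \<Rightarrow> complex) \<Rightarrow> int set" where
  "char_support \<psi> = (THE K. \<exists>c. has_factorization \<psi> K c)"

definition char_diam ::
    "((int \<Rightarrow> 'a::{topological_space, ab_group_add}) \<Rightarrow> complex) \<Rightarrow> int" where
  "char_diam \<psi> = Max (char_support \<psi>) - Min (char_support \<psi>)"

text \<open>
  The number written with double angle brackets around the character. The diameter is at least 1
  in the second case, so the logarithm is nonnegative and \<open>nat\<close> does not truncate.
\<close>

definition char_scale ::
    "nat \<Rightarrow> ((int \<Rightarrow> 'a::{topological_space, ab_group_add}) \<Rightarrow> complex) \<Rightarrow> nat" where
  "char_scale p \<psi> =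
    (if char_diam \<psi> = 0 then 1 else p ^ nat \<lceil>log (real p) (real_of_int (char_diam \<psi>))\<rceil>)"

definition lucas_mixing ::
    "(int \<Rightarrow> ('p::prime_card mod_ring) ^ 's) measure \<Rightarrow> bool" where
  "lucas_mixing \<mu> \<longleftrightarrow>
    (\<forall>\<psi>. is_nontrivial_character \<psi> \<longrightarrow>
      (\<exists>H. cesaro_density_one H \<and>
        ((\<lambda>h. \<integral>a. \<psi> ((one_plus_shift ^^ (h * char_scale CARD('p) \<psi>)) a) \<partial>\<mu>) \<longlongrightarrow> 0)
          (sequentially_in H)))"

end

theory Submission
  imports Defs
begin

text \<open>
  Write \<open>\<Phi> = 1 + \<sigma>\<close> and \<open>F \<psi> j = \<integral> \<psi> \<circ> \<Phi>\<^sup>j d\<mu>\<close> for a character \<open>\<psi>\<close>. Linear combinations of characters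
  are dense in the continuous functions and the uniform measure annihilates nontrivial characters, so
  randomization along \<open>J\<close> means \<open>F \<psi> j \<rightarrow> 0\<close> along \<open>J\<close> for every nontrivial \<open>\<psi>\<close>
  (\<open>weak_star_tendsto_uniform_bernoulli\<close>). Lucas mixing asks for this convergence only along multiples of
  the scale of \<open>\<psi>\<close>, with a density one set depending on \<open>\<psi>\<close>.

  Randomization implies Lucas mixing because the multiples of a fixed number that fall outside a set of
  density one are still negligible among all multiples (\<open>null_density_multiples\<close>).

  For the converse, most times are brought into the reach of Lucas mixing by changing the character:
  if \<open>j = h p\<^sup>n + i\<close>, then \<open>F \<psi> j = F (\<psi> \<circ> \<Phi>\<^sup>i) (h p\<^sup>n)\<close>, and \<open>\<psi> \<circ> \<Phi>\<^sup>i\<close> is a nontrivial character whose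
  diameter exceeds that of \<open>\<psi>\<close> by at most \<open>i\<close>. Unless \<open>i\<close> is among the last few residues modulo \<open>p\<^sup>n\<close>,
  the scale of this character divides \<open>p\<^sup>n\<close>. The number of bad residues is bounded independently of \<open>n\<close>, so
  their density tends to zero as \<open>n\<close> grows, and every level set \<open>{j. \<delta> \<le> |F \<psi> j|}\<close> has density
  zero (\<open>lucas_mixing_imp_null_level_sets\<close>). A diagonal argument over countably many characters that
  suffice for density (\<open>common_density_one_set\<close>) then produces a single \<open>J\<close>.
\<close>

section \<open>Sets of density zero\<close>

definition null_density :: "nat set \<Rightarrow> bool" where
  "null_density B \<longleftrightarrow> (\<lambda>N. real (card (B \<inter> {0..<N})) / real N) \<longlonglongrightarrow> 0"

lemma cesaro_density_one_iff_null_Compl: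
  "cesaro_density_one J \<longleftrightarrow> null_density (- J)"
proof -
  have split: "real (card (J \<inter> {0..<N})) + real (card (- J \<inter> {0..<N})) = real N" for N
  proof -
    have "card (J \<inter> {0..<N} \<union> - J \<inter> {0..<N}) = card (J \<inter> {0..<N}) + card (- J \<inter> {0..<N})"
      by (rule card_Un_disjoint) auto
    moreover have "J \<inter> {0..<N} \<union> - J \<inter> {0..<N} = {0..<N}" by auto
    ultimately show ?thesis by simp
  qed
  let ?f = "\<lambda>N. real (card (J \<inter> {0..<N})) / real N"
  let ?g = "\<lambda>N. real (card (- J \<inter> {0..<N})) / real N"
  have eq: "\<forall>\<^sub>F N in sequentially. ?f N = 1 - ?g N"
    using eventually_gt_at_top[of "0::nat"]
  proof eventually_elim
    case (elim N)
    thus ?case using split[of N] by (simp add: field_simps)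
  qed
  have "?f \<longlonglongrightarrow> 1 \<longleftrightarrow> (\<lambda>N. 1 - ?g N) \<longlonglongrightarrow> 1"
    by (rule tendsto_cong[OF eq])
  also have "\<dots> \<longleftrightarrow> ?g \<longlonglongrightarrow> 0"
  proof
    assume "(\<lambda>N. 1 - ?g N) \<longlonglongrightarrow> 1"
    from tendsto_diff[OF tendsto_const[of 1] this] show "?g \<longlonglongrightarrow> 0" by simp
  next
    assume "?g \<longlonglongrightarrow> 0"
    from tendsto_diff[OF tendsto_const[of 1] this] show "(\<lambda>N. 1 - ?g N) \<longlonglongrightarrow> 1" by simp
  qed
  finally show ?thesis by (simp add: cesaro_density_one_def null_density_def)
qed

lemma null_density_iff:
  "null_density B \<longleftrightarrow> (\<forall>e>0. \<forall>\<^sub>F N in sequentially. real (card (B \<inter> {0..<N})) \<le> e * real N)"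
proof
  assume B: "null_density B"
  show "\<forall>e>0. \<forall>\<^sub>F N in sequentially. real (card (B \<inter> {0..<N})) \<le> e * real N"
  proof (intro allI impI)
    fix e :: real assume "e > 0"
    with B have "\<forall>\<^sub>F N in sequentially. real (card (B \<inter> {0..<N})) / real N < e"
      unfolding null_density_def by (rule order_tendstoD(2))
    thus "\<forall>\<^sub>F N in sequentially. real (card (B \<inter> {0..<N})) \<le> e * real N"
      using eventually_gt_at_top[of "0::nat"]
      by eventually_elim (simp add: field_simps)
  qed
next
  assume R: "\<forall>e>0. \<forall>\<^sub>F N in sequentially. real (card (B \<inter> {0..<N})) \<le> e * real N"
  show "null_density B"
    unfolding null_density_def
  proof (rule tendstoI)
    fix e :: real assume "e > 0"
    hence "\<forall>\<^sub>F N in sequentially. real (card (B \<inter> {0..<N})) \<le> e / 2 * real N" 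
      using R half_gt_zero by blast
    thus "\<forall>\<^sub>F N in sequentially. dist (real (card (B \<inter> {0..<N})) / real N) 0 < e"
      using eventually_gt_at_top[of "0::nat"]
    proof eventually_elim
      case (elim N)
      hence "real (card (B \<inter> {0..<N})) / real N \<le> e / 2" by (simp add: field_simps)
      moreover have "dist (real (card (B \<inter> {0..<N})) / real N) 0 = real (card (B \<inter> {0..<N})) / real N"
        by (simp add: dist_real_def)
      ultimately show ?case using \<open>e > 0\<close> by linarith
    qed
  qed
qed

text \<open>
  For sets that are known to be null only up to a periodic remainder of small positive density, with a
  different decomposition for each tolerance; the constant \<open>C\<close> absorbs the boundary effect of counting
  a periodic set up to \<open>N\<close>.
\<close>

lemma null_density_approx:
  assumes "\<And>e. e > 0 \<Longrightarrow>
    \<exists>Z R C. B \<subseteq> Z \<union> R \<and> null_density Z \<and> (\<forall>N. real (card (R \<inter> {0..<N})) \<le> e * real N + C)"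
  shows "null_density B"
  unfolding null_density_iff
proof (intro allI impI)
  fix e :: real assume e: "e > 0"
  hence "e / 3 > 0" by simp
  from assms[OF this] obtain Z R C where ZR: "B \<subseteq> Z \<union> R" "null_density Z"
    and R: "\<And>N. real (card (R \<inter> {0..<N})) \<le> e / 3 * real N + C"
    by blast
  have "\<forall>\<^sub>F N in sequentially. real (card (Z \<inter> {0..<N})) \<le> e / 3 * real N"
    using ZR(2) \<open>e / 3 > 0\<close> unfolding null_density_iff by blast
  moreover have "\<forall>\<^sub>F N in sequentially. N \<ge> nat \<lceil>3 * C / e\<rceil>"
    by (rule eventually_ge_at_top)
  ultimately show "\<forall>\<^sub>F N in sequentially. real (card (B \<inter> {0..<N})) \<le> e * real N"
  proof eventually_elim
    case (elim N)
    have "card (B \<inter> {0..<N}) \<le> card (Z \<inter> {0..<N} \<union> R \<inter> {0..<N})"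
      using ZR(1) by (intro card_mono) auto
    also have "\<dots> \<le> card (Z \<inter> {0..<N}) + card (R \<inter> {0..<N})"
      by (rule card_Un_le)
    finally have "real (card (B \<inter> {0..<N})) \<le> real (card (Z \<inter> {0..<N})) + real (card (R \<inter> {0..<N}))"
      by linarith
    moreover have "3 * C / e \<le> real N" using elim(2) by linarith
    hence "C \<le> e / 3 * real N" using e by (simp add: field_simps)
    moreover have "e * real N = e / 3 * real N + e / 3 * real N + e / 3 * real N" by simp
    ultimately show ?case using elim(1) R[of N] by linarith
  qed
qed

lemma null_density_subset:
  assumes "null_density Z" "B \<subseteq> Z"
  shows "null_density B"
  by (rule null_density_approx, rule exI[of _ Z], rule exI[of _ "{}"], rule exI[of _ 0])
     (use assms in auto)

lemma null_density_Un:
  assumes "null_density A" "null_density B"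
  shows "null_density (A \<union> B)"
proof (rule null_density_approx)
  fix e :: real assume e: "e > 0"
  with assms(2) have "\<forall>\<^sub>F N in sequentially. real (card (B \<inter> {0..<N})) \<le> e * real N"
    unfolding null_density_iff by blast
  then obtain N0 where N0: "\<And>N. N \<ge> N0 \<Longrightarrow> real (card (B \<inter> {0..<N})) \<le> e * real N"
    by (auto simp: eventually_sequentially)
  have "real (card (B \<inter> {0..<N})) \<le> e * real N + real N0" for N
  proof (cases "N \<ge> N0")
    case True
    thus ?thesis using N0[of N] by simp
  next
    case False
    have "card (B \<inter> {0..<N}) \<le> card {0..<N}" by (intro card_mono) auto
    hence "real (card (B \<inter> {0..<N})) \<le> real N0" using False by simp
    thus ?thesis using e by (simp add: add_increasing)
  qed
  thus "\<exists>Z R C. A \<union> B \<subseteq> Z \<union> R \<and> null_density Z \<and>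
      (\<forall>N. real (card (R \<inter> {0..<N})) \<le> e * real N + C)"
    using assms(1) by blast
qed

lemma null_density_finite:
  assumes "finite B"
  shows "null_density B"
proof (rule null_density_approx)
  fix e :: real assume e: "e > 0"
  have "real (card (B \<inter> {0..<N})) \<le> e * real N + real (card B)" for N
  proof -
    have "card (B \<inter> {0..<N}) \<le> card B" using assms by (intro card_mono) auto
    thus ?thesis using e by (simp add: add_increasing)
  qed
  moreover have "null_density {}" by (simp add: null_density_def)
  ultimately show "\<exists>Z R C. B \<subseteq> Z \<union> R \<and> null_density Z \<and>
      (\<forall>N. real (card (R \<inter> {0..<N})) \<le> e * real N + C)"
    by blast
qed

lemma null_density_UN:
  assumes "finite I" "\<And>i. i \<in> I \<Longrightarrow> null_density (B i)"
  shows "null_density (\<Union>i\<in>I. B i)"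
  using assms by (induction I rule: finite_induct) (auto intro: null_density_Un null_density_finite)

text \<open>
  Since \<open>h \<le> h * q + i\<close>, the part of the image below \<open>N\<close> already comes from the part of \<open>B\<close> below \<open>N\<close>.
\<close>

lemma null_density_affine_image:
  assumes "null_density B" "q > 0"
  shows "null_density ((\<lambda>h. h * q + i) ` B)"
  unfolding null_density_iff
proof (intro allI impI)
  fix e :: real assume "e > 0"
  with assms(1) have "\<forall>\<^sub>F N in sequentially. real (card (B \<inter> {0..<N})) \<le> e * real N"
    unfolding null_density_iff by blast
  thus "\<forall>\<^sub>F N in sequentially. real (card ((\<lambda>h. h * q + i) ` B \<inter> {0..<N})) \<le> e * real N"
  proof eventually_elim
    case (elim N)
    have le: "h \<le> h * q + i" for h
      using assms(2) by (simp add: trans_le_add1)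
    have "(\<lambda>h. h * q + i) ` B \<inter> {0..<N} \<subseteq> (\<lambda>h. h * q + i) ` (B \<inter> {0..<N})"
    proof
      fix j assume "j \<in> (\<lambda>h. h * q + i) ` B \<inter> {0..<N}"
      then obtain h where h: "j = h * q + i" "h \<in> B" "h * q + i < N" by auto
      have "h < N" using le[of h] h(3) by (rule le_less_trans)
      thus "j \<in> (\<lambda>h. h * q + i) ` (B \<inter> {0..<N})" using h by auto
    qed
    hence "card ((\<lambda>h. h * q + i) ` B \<inter> {0..<N}) \<le> card ((\<lambda>h. h * q + i) ` (B \<inter> {0..<N}))"
      by (intro card_mono) auto
    also have "\<dots> \<le> card (B \<inter> {0..<N})" by (rule card_image_le) simp
    finally show ?case using elim by linarith
  qed
qed

text \<open>
  The multiples of \<open>q\<close> in \<open>B\<close> below \<open>N * q\<close> number at most \<open>o(N * q) = o(N)\<close>, because \<open>q\<close> is fixed.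
\<close>

lemma null_density_multiples:
  assumes "null_density B" "q > 0"
  shows "null_density {h. h * q \<in> B}"
  unfolding null_density_iff
proof (intro allI impI)
  fix e :: real assume "e > 0"
  hence "e / real q > 0" using assms(2) by simp
  with assms(1) have ev: "\<forall>\<^sub>F N in sequentially. real (card (B \<inter> {0..<N})) \<le> e / real q * real N"
    unfolding null_density_iff by blast
  have "filterlim (\<lambda>N. N * q) sequentially sequentially"
    using assms(2) by (intro filterlim_subseq) (auto simp: strict_mono_def)
  from eventually_compose_filterlim[OF ev this]
  show "\<forall>\<^sub>F N in sequentially. real (card ({h. h * q \<in> B} \<inter> {0..<N})) \<le> e * real N"
  proof eventually_elim
    case (elim N)
    have "card ({h. h * q \<in> B} \<inter> {0..<N}) = card ((\<lambda>h. h * q) ` ({h. h * q \<in> B} \<inter> {0..<N}))"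
      using assms(2) by (intro card_image[symmetric]) (auto simp: inj_on_def)
    also have "\<dots> \<le> card (B \<inter> {0..<N * q})"
      using assms(2) by (intro card_mono) auto
    finally show ?case using elim assms(2) by simp
  qed
qed

lemma card_residues_below_le:
  fixes q :: nat
  assumes "finite R"
  shows "card ({j. j mod q \<in> R} \<inter> {0..<N}) \<le> card R * (N div q + 1)"
proof -
  have "card ({j. j mod q \<in> R} \<inter> {0..<N}) \<le> card ({..N div q} \<times> R)"
  proof (rule card_inj_on_le[where f = "\<lambda>j. (j div q, j mod q)"])
    show "inj_on (\<lambda>j. (j div q, j mod q)) ({j. j mod q \<in> R} \<inter> {0..<N})"
      by (rule inj_onI) (metis Pair_inject div_mult_mod_eq)
  qed (use assms in \<open>auto intro: div_le_mono\<close>)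
  thus ?thesis by (simp add: card_cartesian_product mult.commute)
qed

text \<open>
  The Koopman--von Neumann diagonal argument: at time \<open>j\<close> avoid \<open>B (kappa j)\<close>, where the index \<open>kappa j\<close>
  tends to infinity so slowly that \<open>B (kappa j)\<close> has occupied at most the fraction \<open>1 / kappa j\<close> of
  every initial segment of length at least \<open>j\<close>. As the sets increase, all times skipped before \<open>N\<close> lie
  in \<open>B (kappa N)\<close>, so they have density zero; and each \<open>B k\<close> is avoided from the moment
  \<open>kappa\<close> reaches \<open>k\<close>.
\<close>

lemma null_density_diagonal:
  fixes B :: "nat \<Rightarrow> nat set"
  assumes null: "\<And>k. null_density (B k)" and mono: "incseq B"
  obtains J where "cesaro_density_one J" "\<And>k. finite (J \<inter> B k)"
proof -
  let ?ok = "\<lambda>N k. \<forall>M\<ge>N. k * card (B k \<inter> {0..<M}) \<le> M"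
  define K where "K N = {k. k \<le> N \<and> ?ok N k}" for N
  define kappa where "kappa N = Max (K N)" for N
  have K_fin: "finite (K N)" for N
    by (rule finite_subset[of _ "{..N}"]) (auto simp: K_def)
  \<comment> \<open>Writing the bound as a product makes the index 0 always admissible.\<close>
  have K_ne: "K N \<noteq> {}" for N
    by (auto simp: K_def intro: exI[of _ 0])
  have kappa_in: "kappa N \<in> K N" for N
    unfolding kappa_def using K_fin K_ne by (rule Max_in)
  have K_mono: "K N \<subseteq> K N'" if "N \<le> N'" for N N'
    using that by (auto simp: K_def)
  have kappa_mono: "kappa N \<le> kappa N'" if "N \<le> N'" for N N'
    unfolding kappa_def using K_mono[OF that] K_ne K_fin by (rule Max_mono)
  have kappa_ge: "\<forall>\<^sub>F N in sequentially. k \<le> kappa N" for k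
  proof -
    have "\<forall>\<^sub>F N in sequentially. real (card (B k \<inter> {0..<N})) \<le> 1 / (real k + 1) * real N"
      by (rule null[of k, unfolded null_density_iff, rule_format]) (simp add: add_nonneg_pos)
    then obtain N0 where N0: "\<And>N. N \<ge> N0 \<Longrightarrow> real (card (B k \<inter> {0..<N})) \<le> 1 / (real k + 1) * real N"
      by (auto simp: eventually_sequentially)
    have "?ok N0 k"
    proof (intro allI impI)
      fix M assume "M \<ge> N0"
      from N0[OF this] have "(real k + 1) * real (card (B k \<inter> {0..<M})) \<le> real M"
        by (simp add: field_simps)
      hence "real (k * card (B k \<inter> {0..<M})) \<le> real M" by (simp add: algebra_simps)
      thus "k * card (B k \<inter> {0..<M}) \<le> M" by linarith
    qed
    hence "k \<in> K (max N0 k)" by (auto simp: K_def)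
    hence "k \<le> kappa N" if "N \<ge> max N0 k" for N
      unfolding kappa_def using K_mono[OF that] K_fin by (intro Max_ge) auto
    thus ?thesis unfolding eventually_sequentially by blast
  qed
  define J where "J = {j. j \<notin> B (kappa j)}"
  have "null_density (- J)"
    unfolding null_density_iff
  proof (intro allI impI)
    fix e :: real assume e: "e > 0"
    obtain k :: nat where k: "1 / e < real k" using reals_Archimedean2 by blast
    have kpos: "real k > 0" 
      by (rule less_trans[OF _ k]) (use e in simp)
    show "\<forall>\<^sub>F N in sequentially. real (card (- J \<inter> {0..<N})) \<le> e * real N"
      using kappa_ge[of k]
    proof eventually_elim
      case (elim N)
      have "- J \<inter> {0..<N} \<subseteq> B (kappa N) \<inter> {0..<N}"
      proof
        fix j assume j: "j \<in> - J \<inter> {0..<N}"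
        hence "B (kappa j) \<subseteq> B (kappa N)"
          by (intro incseqD[OF mono] kappa_mono) auto
        thus "j \<in> B (kappa N) \<inter> {0..<N}" using j by (auto simp: J_def)
      qed
      hence "card (- J \<inter> {0..<N}) \<le> card (B (kappa N) \<inter> {0..<N})"
        by (intro card_mono) auto
      hence "k * card (- J \<inter> {0..<N}) \<le> kappa N * card (B (kappa N) \<inter> {0..<N})"
        using elim by (intro mult_le_mono)
      also have "\<dots> \<le> N" using kappa_in[of N] by (auto simp: K_def)
      finally have "real (k * card (- J \<inter> {0..<N})) \<le> real N" by linarith
      hence "real (card (- J \<inter> {0..<N})) \<le> 1 / real k * real N"
        using kpos by (simp add: field_simps)
      also have "\<dots> \<le> e * real N"
        using k kpos e by (intro mult_right_mono) (auto simp: field_simps)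
      finally show ?case .
    qed
  qed
  moreover have "finite (J \<inter> B k)" for k
  proof -
    obtain N0 where N0: "\<And>N. N \<ge> N0 \<Longrightarrow> k \<le> kappa N"
      using kappa_ge[of k] by (auto simp: eventually_sequentially)
    have "j < N0" if "j \<in> J \<inter> B k" for j
    proof (rule ccontr)
      assume "\<not> j < N0"
      hence "B k \<subseteq> B (kappa j)" by (intro incseqD[OF mono] N0) simp
      thus False using that by (auto simp: J_def)
    qed
    hence "J \<inter> B k \<subseteq> {..<N0}" by auto
    thus ?thesis by (rule finite_subset) simp
  qed
  ultimately show ?thesis
    by (intro that[of J]) (simp_all add: cesaro_density_one_iff_null_Compl)
qed

lemma eventually_sequentially_in:
  "eventually P (sequentially_in J) \<longleftrightarrow> (\<forall>\<^sub>F j in sequentially. j \<in> J \<longrightarrow> P j)"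
  by (simp add: sequentially_in_def eventually_inf_principal)

lemma null_density_level_set:
  fixes f :: "nat \<Rightarrow> 'b::real_normed_vector"
  assumes "cesaro_density_one J" "(f \<longlongrightarrow> 0) (sequentially_in J)" "\<delta> > 0"
  shows "null_density {j. \<delta> \<le> norm (f j)}"
proof -
  have "\<forall>\<^sub>F j in sequentially_in J. norm (f j) < \<delta>"
    using tendstoD[OF assms(2,3)] by (simp add: dist_norm)
  then obtain N where N: "\<And>j. j \<ge> N \<Longrightarrow> j \<in> J \<Longrightarrow> norm (f j) < \<delta>"
    by (auto simp: eventually_sequentially_in eventually_sequentially)
  have "{j. \<delta> \<le> norm (f j)} \<subseteq> - J \<union> {..<N}"
    using N by (force simp: not_less[symmetric])
  moreover have "null_density (- J \<union> {..<N})"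
    using assms(1) null_density_finite[of "{..<N}"]
    by (intro null_density_Un) (auto simp: cesaro_density_one_iff_null_Compl)
  ultimately show ?thesis by (rule null_density_subset[rotated])
qed

text \<open>
  Countably many sequences that tend to zero in density do so along one common set. The sets handed to
  the diagonal argument collect, at stage \<open>k\<close>, the level sets of the first \<open>k + 1\<close> sequences at height
  \<open>1 / (k + 1)\<close>, so that avoiding each stage eventually gives convergence of every sequence.
\<close>

lemma common_density_one_set:
  fixes f :: "'i \<Rightarrow> nat \<Rightarrow> 'b::real_normed_vector"
  assumes "countable I"
    and null: "\<And>i \<delta>. i \<in> I \<Longrightarrow> \<delta> > 0 \<Longrightarrow> null_density {j. \<delta> \<le> norm (f i j)}"
  obtains J where "cesaro_density_one J" "\<And>i. i \<in> I \<Longrightarrow> (f i \<longlongrightarrow> 0) (sequentially_in J)"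
proof -
  define B where
    "B k = (\<Union>i\<in>{i\<in>I. to_nat_on I i \<le> k}. {j. 1 / (real k + 1) \<le> norm (f i j)})" for k
  have fin: "finite {i\<in>I. to_nat_on I i \<le> k}" for k
    by (rule finite_imageD[where f = "to_nat_on I"], rule finite_subset[of _ "{..k}"])
       (auto intro: inj_on_subset[OF inj_on_to_nat_on[OF assms(1)]])
  have "null_density (B k)" for k
    unfolding B_def using fin null by (intro null_density_UN) (auto simp: add_nonneg_pos)
  moreover have "incseq B"
  proof (rule incseq_SucI)
    fix k
    have "1 / (real (Suc k) + 1) \<le> 1 / (real k + 1)" by (simp add: field_simps)
    thus "B k \<subseteq> B (Suc k)" unfolding B_def by (fastforce intro: order_trans)
  qed
  ultimately obtain J where J: "cesaro_density_one J" "\<And>k. finite (J \<inter> B k)"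
    using null_density_diagonal by blast
  have "(f i \<longlongrightarrow> 0) (sequentially_in J)" if i: "i \<in> I" for i
  proof (rule tendstoI)
    fix e :: real assume e: "e > 0"
    obtain n :: nat where n: "1 / e < real n" using reals_Archimedean2 by blast
    define k where "k = max n (to_nat_on I i)"
    have "1 / e < real k + 1" using n by (simp add: k_def)
    hence k: "1 / (real k + 1) < e" using e by (simp add: field_simps)
    obtain N where N: "\<And>j. j \<in> J \<inter> B k \<Longrightarrow> j < N"
      using J(2)[of k] by (auto simp: finite_nat_set_iff_bounded)
    have "norm (f i j) < e" if "j \<ge> N" "j \<in> J" for j
    proof -
      have "j \<notin> B k" using N[of j] that by auto
      hence "norm (f i j) < 1 / (real k + 1)"
        using i by (auto simp: B_def k_def not_le)
      thus ?thesis using k by simp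
    qed
    thus "\<forall>\<^sub>F j in sequentially_in J. dist (f i j) 0 < e"
      by (auto simp: eventually_sequentially_in eventually_sequentially dist_norm)
  qed
  with J(1) show ?thesis by (rule that)
qed

section \<open>Topology of configuration spaces\<close>

text \<open>
  The Stone--Weierstrass theorem needs the configuration space to be Hausdorff, and continuity of
  \<open>one_plus_shift\<close> uses that the alphabet is discrete. The weaker separation classes come first because
  their arities have to be at least as general as that of \<open>t2_space\<close>, whereas those inherited from metric
  spaces are not.
\<close>

instance vec :: (t0_space, finite) t0_space
proof
  fix x y :: "'a ^ 'b" assume "x \<noteq> y"
  then obtain i where i: "x $ i \<noteq> y $ i" by (auto simp: vec_eq_iff)
  obtain U where U: "open U" "\<not> (x $ i \<in> U \<longleftrightarrow> y $ i \<in> U)"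
    using iffD1[OF separation_t0 i] by blast
  thus "\<exists>U. open U \<and> \<not> (x \<in> U \<longleftrightarrow> y \<in> U)"
    by (intro exI[of _ "(\<lambda>z. z $ i) -` U"]) (auto intro: open_vimage_vec_nth)
qed

instance vec :: (t1_space, finite) t1_space
proof
  fix x y :: "'a ^ 'b" assume "x \<noteq> y"
  then obtain i where i: "x $ i \<noteq> y $ i" by (auto simp: vec_eq_iff)
  obtain U where U: "open U" "x $ i \<in> U" "y $ i \<notin> U"
    using t1_space[OF i] by blast
  thus "\<exists>U. open U \<and> x \<in> U \<and> y \<notin> U"
    by (intro exI[of _ "(\<lambda>z. z $ i) -` U"]) (auto intro: open_vimage_vec_nth)
qed

instance vec :: (t2_space, finite) t2_space
proof
  fix x y :: "'a ^ 'b" assume "x \<noteq> y"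
  then obtain i where i: "x $ i \<noteq> y $ i" by (auto simp: vec_eq_iff)
  obtain U V where U: "open U" "open V" "x $ i \<in> U" "y $ i \<in> V" "U \<inter> V = {}"
    using hausdorff[OF i] by blast
  thus "\<exists>U V. open U \<and> open V \<and> x \<in> U \<and> y \<in> V \<and> U \<inter> V = {}"
    by (intro exI[of _ "(\<lambda>z. z $ i) -` U"] exI[of _ "(\<lambda>z. z $ i) -` V"]) (auto intro: open_vimage_vec_nth)
qed

instance vec :: (discrete_topology, finite) discrete_topology
proof
  fix A :: "('a ^ 'b) set"
  show "open A"
    unfolding open_vec_def
  proof (intro ballI)
    fix x assume "x \<in> A"
    thus "\<exists>S. (\<forall>i. open (S i) \<and> x $ i \<in> S i) \<and> (\<forall>y. (\<forall>i. y $ i \<in> S i) \<longrightarrow> y \<in> A)"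
      by (intro exI[of _ "\<lambda>i. {x $ i}"]) (auto simp: discrete_topology_class.open_discrete simp flip: vec_eq_iff)
  qed
qed

instance "fun" :: (type, t0_space) t0_space
proof
  fix x y :: "'a \<Rightarrow> 'b" assume "x \<noteq> y"
  then obtain i where i: "x i \<noteq> y i" by blast
  obtain U where U: "open U" "\<not> (x i \<in> U \<longleftrightarrow> y i \<in> U)"
    using iffD1[OF separation_t0 i] by blast
  thus "\<exists>U. open U \<and> \<not> (x \<in> U \<longleftrightarrow> y \<in> U)"
    by (intro exI[of _ "(\<lambda>z. z i) -` U"]) (auto intro: open_vimage)
qed

instance "fun" :: (type, t1_space) t1_space
proof
  fix x y :: "'a \<Rightarrow> 'b" assume "x \<noteq> y"
  then obtain i where i: "x i \<noteq> y i" by blast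
  obtain U where U: "open U" "x i \<in> U" "y i \<notin> U"
    using t1_space[OF i] by blast
  thus "\<exists>U. open U \<and> x \<in> U \<and> y \<notin> U"
    by (intro exI[of _ "(\<lambda>z. z i) -` U"]) (auto intro: open_vimage)
qed

instance "fun" :: (type, t2_space) t2_space
proof
  fix x y :: "'a \<Rightarrow> 'b" assume "x \<noteq> y"
  then obtain i where i: "x i \<noteq> y i" by blast
  obtain U V where U: "open U" "open V" "x i \<in> U" "y i \<in> V" "U \<inter> V = {}"
    using hausdorff[OF i] by blast
  thus "\<exists>U V. open U \<and> open V \<and> x \<in> U \<and> y \<in> V \<and> U \<inter> V = {}"
    by (intro exI[of _ "(\<lambda>z. z i) -` U"] exI[of _ "(\<lambda>z. z i) -` V"]) (auto intro: open_vimage)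
qed

lemma compact_UNIV_finite_alphabet: "compact (UNIV :: ('i \<Rightarrow> 'a::{finite, topological_space}) set)"
proof -
  have "compactin (product_topology (\<lambda>_::'i. euclidean :: 'a topology) UNIV) (PiE UNIV (\<lambda>_. UNIV))"
    unfolding compactin_PiE by (simp add: finite_imp_compact)
  thus ?thesis by (simp add: euclidean_product_topology)
qed

lemma continuous_on_discrete_binary:
  fixes h :: "'b::discrete_topology \<Rightarrow> 'c::discrete_topology \<Rightarrow> 'd::topological_space"
  assumes "continuous_on UNIV f" "continuous_on UNIV g"
  shows "continuous_on UNIV (\<lambda>x. h (f x) (g x))"
  unfolding continuous_on_open_vimage[OF open_UNIV]
proof (intro allI impI)
  fix S :: "'d set"
  have "(\<lambda>x. h (f x) (g x)) -` S \<inter> UNIV =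
      (\<Union>(u, v)\<in>{(u, v). h u v \<in> S}. f -` {u} \<inter> g -` {v})"
    by auto
  moreover have "open (f -` {u} \<inter> g -` {v})" for u v
    using assms by (intro open_Int open_vimage discrete_topology_class.open_discrete)
  ultimately show "open ((\<lambda>x. h (f x) (g x)) -` S \<inter> UNIV)" by auto
qed

section \<open>Characters and their active sites\<close>

definition site_config :: "int \<Rightarrow> 'a::zero \<Rightarrow> int \<Rightarrow> 'a" where
  "site_config k x = (\<lambda>m. if m = k then x else 0)"

lemma site_config_add: "site_config k (x + y :: 'a::monoid_add) = site_config k x + site_config k y"
  by (auto simp: site_config_def fun_eq_iff)

lemma character_zero:
  assumes "is_character \<psi>"
  shows "\<psi> 0 = 1"
proof -
  have "\<psi> (0 + 0) = \<psi> 0 * \<psi> 0" "norm (\<psi> 0) = 1"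
    using assms unfolding is_character_def by blast+
  thus ?thesis by auto
qed

lemma character_add: "is_character \<psi> \<Longrightarrow> \<psi> (x + y) = \<psi> x * \<psi> y"
  and norm_character: "is_character \<psi> \<Longrightarrow> norm (\<psi> x) = 1"
  and continuous_character: "is_character \<psi> \<Longrightarrow> continuous_on UNIV \<psi>"
  unfolding is_character_def by blast+

lemma character_sum:
  assumes "is_character \<psi>" "finite S"
  shows "\<psi> (\<Sum>k\<in>S. f k) = (\<Prod>k\<in>S. \<psi> (f k))"
  using assms(2) by induction (simp_all add: character_zero character_add assms(1))

text \<open>
  The circle has no small subgroups. On the unit circle near \<open>1\<close>, squaring expands the distance to
  \<open>1\<close>: \<open>|z\<^sup>2 - 1| = |z + 1| |z - 1| \<ge> 3/2 |z - 1|\<close>. A set closed under doubling on which a character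
  stays near \<open>1\<close> is therefore sent to \<open>1\<close>.
\<close>

lemma character_one_if_near_one:
  assumes \<psi>: "is_character \<psi>"
    and closed: "\<And>x. x \<in> U \<Longrightarrow> x + x \<in> U"
    and near: "\<And>x. x \<in> U \<Longrightarrow> norm (\<psi> x - 1) < 1 / 2"
    and a: "a \<in> U"
  shows "\<psi> a = 1"
proof (rule ccontr)
  assume ne: "\<psi> a \<noteq> 1"
  have grow: "(3 / 2) ^ n * norm (\<psi> x - 1) < 1 / 2" if "x \<in> U" for n x
    using that
  proof (induction n arbitrary: x)
    case 0
    thus ?case using near by simp
  next
    case (Suc n)
    have "2 - norm (\<psi> x + 1) \<le> norm (2 - (\<psi> x + 1))"
      using norm_triangle_ineq2[of 2 "\<psi> x + 1"] by simp
    also have "\<dots> = norm (\<psi> x - 1)" by (simp add: norm_minus_commute)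
    finally have "3 / 2 \<le> norm (\<psi> x + 1)" using near[OF Suc.prems] by linarith
    hence "(3 / 2) ^ n * (3 / 2 * norm (\<psi> x - 1)) \<le> (3 / 2) ^ n * (norm (\<psi> x + 1) * norm (\<psi> x - 1))"
      by (intro mult_left_mono mult_right_mono) auto
    hence "(3 / 2) ^ Suc n * norm (\<psi> x - 1) \<le> (3 / 2) ^ n * (norm (\<psi> x + 1) * norm (\<psi> x - 1))"
      by (simp only: power_Suc ac_simps)
    also have "norm (\<psi> x + 1) * norm (\<psi> x - 1) = norm (\<psi> (x + x) - 1)"
      by (simp add: character_add[OF \<psi>] algebra_simps flip: norm_mult)
    also have "(3 / 2) ^ n * \<dots> < 1 / 2" by (rule Suc.IH[OF closed[OF Suc.prems]])
    finally show ?case .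
  qed
  obtain n where "1 / 2 / norm (\<psi> a - 1) < (3 / 2) ^ n"
    using real_arch_pow[of "3 / 2"] by auto
  hence "1 / 2 < (3 / 2) ^ n * norm (\<psi> a - 1)" using ne by (simp add: field_simps)
  with grow[OF a, of n] show False by linarith
qed

lemma open_cylinder_nbhd:
  fixes U :: "(int \<Rightarrow> 'a::topological_space) set"
  assumes "open U" "x \<in> U"
  obtains F where "finite F" "\<And>y. (\<And>k. k \<in> F \<Longrightarrow> y k = x k) \<Longrightarrow> y \<in> U"
proof -
  have "openin (product_topology (\<lambda>_::int. euclidean :: 'a topology) UNIV) U"
    using assms(1) by (simp add: open_fun_def)
  then obtain X where X: "finite {i. X i \<noteq> (UNIV :: 'a set)}" "x \<in> PiE UNIV X" "PiE UNIV X \<subseteq> U"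
    using assms(2) unfolding openin_product_topology_alt by fastforce
  show ?thesis
  proof (rule that[OF X(1)])
    fix y assume y: "\<And>k. k \<in> {i. X i \<noteq> UNIV} \<Longrightarrow> y k = x k"
    have "y k \<in> X k" for k
      using y[of k] X(2) by (cases "X k = UNIV") (auto simp: PiE_def Pi_def)
    hence "y \<in> PiE UNIV X" by auto
    thus "y \<in> U" using X(3) by blast
  qed
qed

text \<open>
  A neighbourhood of \<open>0\<close> on which the character is near \<open>1\<close> contains the whole subgroup of
  configurations vanishing on some finite set of sites, and such a subgroup must be sent to \<open>1\<close>.
\<close>

lemma character_finitely_determined:
  fixes \<psi> :: "(int \<Rightarrow> 'a::{topological_space, ab_group_add}) \<Rightarrow> complex"
  assumes "is_character \<psi>"
  obtains F where "finite F" "\<And>a. (\<And>k. k \<in> F \<Longrightarrow> a k = 0) \<Longrightarrow> \<psi> a = 1"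
proof -
  have "open (\<psi> -` ball 1 (1 / 2))"
    by (intro open_vimage continuous_character[OF assms]) simp
  moreover have "0 \<in> \<psi> -` ball 1 (1 / 2)"
    by (simp add: character_zero[OF assms])
  ultimately obtain F where F: "finite F"
    "\<And>a. (\<And>k. k \<in> F \<Longrightarrow> a k = 0 k) \<Longrightarrow> a \<in> \<psi> -` ball 1 (1 / 2)"
    by (rule open_cylinder_nbhd) blast
  have "\<psi> a = 1" if "\<And>k. k \<in> F \<Longrightarrow> a k = 0" for a
  proof (rule character_one_if_near_one[OF assms, where U = "{a. \<forall>k\<in>F. a k = 0}"])
    fix x :: "int \<Rightarrow> 'a" assume "x \<in> {a. \<forall>k\<in>F. a k = 0}"
    hence "x \<in> \<psi> -` ball 1 (1 / 2)" by (intro F(2)) auto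
    thus "norm (\<psi> x - 1) < 1 / 2" by (simp add: dist_norm norm_minus_commute)
  qed (use that in auto)
  with F(1) show ?thesis by (rule that)
qed

lemma is_character_site_config:
  assumes "is_character \<psi>"
  shows "is_character (\<lambda>x. \<psi> (site_config k x))"
proof -
  have "continuous_on UNIV (\<lambda>x. site_config k x :: int \<Rightarrow> 'a)"
    unfolding site_config_def
  proof (rule continuous_on_coordinatewise_then_product)
    show "continuous_on UNIV (\<lambda>x::'a. if m = k then x else 0)" for m
      by (cases "m = k") auto
  qed
  hence "continuous_on UNIV (\<lambda>x. \<psi> (site_config k x))"
    by (rule continuous_on_compose2[OF continuous_character[OF assms]]) simp
  thus ?thesis
    by (simp add: is_character_def site_config_add character_add[OF assms] norm_character[OF assms])
qed

text \<open>
  For a character this is the index set of its factorization, but described by values of the character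
  rather than by a definite description.
\<close>

definition active_sites :: "((int \<Rightarrow> 'a::zero) \<Rightarrow> complex) \<Rightarrow> int set" where
  "active_sites \<psi> = {k. \<exists>x. \<psi> (site_config k x) \<noteq> 1}"

text \<open>
  If \<open>F\<close> is a finite set of sites that determines \<open>\<psi>\<close>, then \<open>a\<close> and the sum of its one-site pieces over
  \<open>F\<close> have the same image; multiplicativity splits that image, and inactive sites contribute \<open>1\<close>.
\<close>

lemma
  fixes \<psi> :: "(int \<Rightarrow> 'a::{topological_space, ab_group_add}) \<Rightarrow> complex"
  assumes \<psi>: "is_character \<psi>"
  shows finite_active_sites: "finite (active_sites \<psi>)"
    and character_factorization: "\<psi> a = (\<Prod>k\<in>active_sites \<psi>. \<psi> (site_config k (a k)))"
proof -
  obtain F where F: "finite F" "\<And>a. (\<And>k. k \<in> F \<Longrightarrow> a k = 0) \<Longrightarrow> \<psi> a = 1"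
    using character_finitely_determined[OF \<psi>] by blast
  have sub: "active_sites \<psi> \<subseteq> F"
  proof
    fix k assume "k \<in> active_sites \<psi>"
    then obtain x where x: "\<psi> (site_config k x) \<noteq> 1" unfolding active_sites_def by blast
    show "k \<in> F"
    proof (rule ccontr)
      assume "k \<notin> F"
      hence "\<psi> (site_config k x) = 1" by (intro F(2)) (auto simp: site_config_def)
      thus False using x by simp
    qed
  qed
  thus "finite (active_sites \<psi>)" using F(1) by (rule finite_subset)
  let ?b = "\<Sum>k\<in>F. site_config k (a k)"
  have "(\<Sum>k\<in>S. site_config k (a k)) m = (if m \<in> S then a m else 0)" if "finite S" for S m
    using that by induction (auto simp: site_config_def)
  hence "?b m = a m" if "m \<in> F" for m
    using that F(1) by simp
  hence "\<psi> (a - ?b) = 1" by (intro F(2)) simp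
  hence "\<psi> a = \<psi> ?b"
    using character_add[OF \<psi>, of "a - ?b" ?b] by simp
  also have "\<dots> = (\<Prod>k\<in>F. \<psi> (site_config k (a k)))" by (rule character_sum[OF \<psi> F(1)])
  also have "\<dots> = (\<Prod>k\<in>active_sites \<psi>. \<psi> (site_config k (a k)))"
    using sub F(1) by (intro prod.mono_neutral_right) (auto simp: active_sites_def)
  finally show "\<psi> a = (\<Prod>k\<in>active_sites \<psi>. \<psi> (site_config k (a k)))" .
qed

lemma char_support_eq_active_sites:
  fixes \<psi> :: "(int \<Rightarrow> 'a::{topological_space, ab_group_add}) \<Rightarrow> complex"
  assumes \<psi>: "is_character \<psi>"
  shows "char_support \<psi> = active_sites \<psi>"
proof -
  have fact: "has_factorization \<psi> (active_sites \<psi>) (\<lambda>k x. \<psi> (site_config k x))"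
    unfolding has_factorization_def is_nontrivial_character_def
  proof (intro conjI ballI allI)
    show "\<exists>x. \<psi> (site_config k x) \<noteq> 1" if "k \<in> active_sites \<psi>" for k
      using that unfolding active_sites_def by blast
  qed (rule finite_active_sites[OF \<psi>] is_character_site_config[OF \<psi>] character_factorization[OF \<psi>])+
  show ?thesis
    unfolding char_support_def
  proof (rule the_equality)
    show "\<exists>c. has_factorization \<psi> (active_sites \<psi>) c" using fact by blast
    show "K = active_sites \<psi>" if "\<exists>c. has_factorization \<psi> K c" for K
      using that fact has_factorization_unique by blast
  qed
qed

lemma active_sites_nonempty:
  fixes \<psi> :: "(int \<Rightarrow> 'a::{topological_space, ab_group_add}) \<Rightarrow> complex"
  assumes "is_nontrivial_character \<psi>"
  shows "active_sites \<psi> \<noteq> {}"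
proof
  assume "active_sites \<psi> = {}"
  moreover have "is_character \<psi>" using assms by (simp add: is_nontrivial_character_def)
  ultimately have "\<psi> a = 1" for a using character_factorization[of \<psi> a] by simp
  thus False using assms by (simp add: is_nontrivial_character_def)
qed

lemma character_cong:
  fixes \<psi> :: "(int \<Rightarrow> 'a::{topological_space, ab_group_add}) \<Rightarrow> complex"
  assumes "is_character \<psi>" "\<And>k. k \<in> active_sites \<psi> \<Longrightarrow> a k = b k"
  shows "\<psi> a = \<psi> b"
  unfolding character_factorization[OF assms(1), of a] character_factorization[OF assms(1), of b]
  by (rule prod.cong) (simp_all add: assms(2))

section \<open>Iterates of the shift map and the scale of a character\<close>

lemma one_plus_shift_apply: "one_plus_shift a m = a m + a (m + 1)"
  by (simp add: one_plus_shift_def shift_def)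

lemma one_plus_shift_iter_add:
  fixes a b :: "int \<Rightarrow> 'a::ab_semigroup_add"
  shows "(one_plus_shift ^^ n) (a + b) = (one_plus_shift ^^ n) a + (one_plus_shift ^^ n) b"
proof (induction n)
  case (Suc n)
  thus ?case by (simp add: fun_eq_iff one_plus_shift_apply ac_simps)
qed simp

text \<open>
  The polynomial \<open>(1 + \<sigma>)\<^sup>n\<close> has constant term \<open>1\<close> and \<open>\<sigma>\<close> moves values to the left: the rightmost entry
  of a configuration survives unchanged, and the support grows by at most \<open>n\<close> to the left.
\<close>

lemma one_plus_shift_iter_above:
  fixes a :: "int \<Rightarrow> 'a::monoid_add"
  assumes "\<And>m. m > k \<Longrightarrow> a m = 0"
  shows "m > k \<Longrightarrow> (one_plus_shift ^^ n) a m = 0" and "(one_plus_shift ^^ n) a k = a k"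
proof (induction n arbitrary: m)
  case 0
  {
    case 1 thus ?case using assms by simp
  next
    case 2 thus ?case by simp
  }
next
  case (Suc n)
  {
    case 1 thus ?case using Suc by (simp add: one_plus_shift_apply)
  next
    case 2 thus ?case using Suc by (simp add: one_plus_shift_apply)
  }
qed

lemma one_plus_shift_iter_below:
  fixes a :: "int \<Rightarrow> 'a::monoid_add"
  assumes "\<And>m. m < k \<Longrightarrow> a m = 0"
  shows "m < k - int n \<Longrightarrow> (one_plus_shift ^^ n) a m = 0"
proof (induction n arbitrary: m)
  case (Suc n)
  hence "(one_plus_shift ^^ n) a m = 0" "(one_plus_shift ^^ n) a (m + 1) = 0"
    by simp_all
  thus ?case by (simp add: one_plus_shift_apply[of "(one_plus_shift ^^ n) a"])
qed (simp add: assms)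

lemma continuous_one_plus_shift_iter:
  "continuous_on UNIV (one_plus_shift ^^ n :: (int \<Rightarrow> 'a::{discrete_topology, plus}) \<Rightarrow> _)"
proof (induction n)
  case 0
  show ?case by (simp add: id_def)
next
  case (Suc n)
  have "continuous_on UNIV (one_plus_shift :: (int \<Rightarrow> 'a) \<Rightarrow> _)"
  proof (rule continuous_on_coordinatewise_then_product)
    show "continuous_on UNIV (\<lambda>a. one_plus_shift a m :: 'a)" for m
      unfolding one_plus_shift_apply
      by (rule continuous_on_discrete_binary[where h = "(+)"]) simp_all
  qed
  thus ?case
    unfolding funpow.simps using Suc by (intro continuous_on_compose) (auto intro: continuous_on_subset)
qed

lemma is_character_iter:
  fixes \<psi> :: "(int \<Rightarrow> 'a::{discrete_topology, ab_group_add}) \<Rightarrow> complex"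
  assumes "is_character \<psi>"
  shows "is_character (\<lambda>a. \<psi> ((one_plus_shift ^^ n) a))"
  unfolding is_character_def
proof (intro conjI allI)
  show "continuous_on UNIV (\<lambda>a. \<psi> ((one_plus_shift ^^ n) a))"
    by (rule continuous_on_compose2[OF continuous_character[OF assms] continuous_one_plus_shift_iter]) simp
qed (simp_all add: one_plus_shift_iter_add character_add[OF assms] norm_character[OF assms])

text \<open>
  A configuration concentrated on the leftmost active site \<open>k\<close> is changed by \<open>\<Phi>\<^sup>n\<close> only at sites left of
  \<open>k\<close>, which \<open>\<psi>\<close> does not see.
\<close>

lemma is_nontrivial_character_iter:
  fixes \<psi> :: "(int \<Rightarrow> 'a::{discrete_topology, ab_group_add}) \<Rightarrow> complex"
  assumes nt: "is_nontrivial_character \<psi>"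
  shows "is_nontrivial_character (\<lambda>a. \<psi> ((one_plus_shift ^^ n) a))"
proof -
  have \<psi>: "is_character \<psi>" using nt by (simp add: is_nontrivial_character_def)
  define k where "k = Min (active_sites \<psi>)"
  have kin: "k \<in> active_sites \<psi>"
    unfolding k_def using finite_active_sites[OF \<psi>] active_sites_nonempty[OF nt] by (rule Min_in)
  then obtain x where x: "\<psi> (site_config k x) \<noteq> 1" by (auto simp: active_sites_def)
  have "\<psi> ((one_plus_shift ^^ n) (site_config k x)) = \<psi> (site_config k x)"
  proof (rule character_cong[OF \<psi>])
    fix m assume "m \<in> active_sites \<psi>"
    hence "m \<ge> k" unfolding k_def using finite_active_sites[OF \<psi>] by simp
    moreover have zero: "site_config k x j = 0" if "j > k" for j using that by (simp add: site_config_def)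
    ultimately show "(one_plus_shift ^^ n) (site_config k x) m = site_config k x m"
      using one_plus_shift_iter_above[of k "site_config k x", OF zero]
      by (cases "m = k") (auto simp: zero)
  qed
  thus ?thesis
    using x is_character_iter[OF \<psi>, of n] unfolding is_nontrivial_character_def by metis
qed

text \<open>
  A site \<open>k\<close> can be active for \<open>\<psi> \<circ> \<Phi>\<^sup>n\<close> only if \<open>\<Phi>\<^sup>n\<close> carries something from \<open>k\<close> to an active site of \<open>\<psi>\<close>,
  and it carries values only to \<open>{k - n..k}\<close>.
\<close>

lemma char_diam_iter_le:
  fixes \<psi> :: "(int \<Rightarrow> 'a::{discrete_topology, ab_group_add}) \<Rightarrow> complex"
  assumes nt: "is_nontrivial_character \<psi>"
  shows "char_diam (\<lambda>a. \<psi> ((one_plus_shift ^^ n) a)) \<le> char_diam \<psi> + int n"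
proof -
  have \<psi>: "is_character \<psi>" using nt by (simp add: is_nontrivial_character_def)
  let ?\<psi> = "\<lambda>a. \<psi> ((one_plus_shift ^^ n) a)"
  note nt' = is_nontrivial_character_iter[OF nt, of n]
  note \<psi>' = is_character_iter[OF \<psi>, of n]
  have bounds: "Min (active_sites \<psi>) \<le> k \<and> k \<le> Max (active_sites \<psi>) + int n" if k: "k \<in> active_sites ?\<psi>" for k
  proof -
    obtain x where x: "?\<psi> (site_config k x) \<noteq> 1"
      using k unfolding active_sites_def by blast
    have "\<exists>m\<in>active_sites \<psi>. (one_plus_shift ^^ n) (site_config k x) m \<noteq> 0"
    proof (rule ccontr)
      assume "\<not> ?thesis"
      hence "?\<psi> (site_config k x) = \<psi> 0" by (intro character_cong[OF \<psi>]) auto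
      thus False using x character_zero[OF \<psi>] by simp
    qed
    then obtain m where m: "m \<in> active_sites \<psi>" "(one_plus_shift ^^ n) (site_config k x) m \<noteq> 0" by blast
    have "site_config k x j = 0" if "j > k" for j using that by (simp add: site_config_def)
    from one_plus_shift_iter_above(1)[of k "site_config k x" m n, OF this] m(2) have "m \<le> k"
      by force
    moreover have "site_config k x j = 0" if "j < k" for j using that by (simp add: site_config_def)
    from one_plus_shift_iter_below[of k "site_config k x" m n, OF this] m(2) have "m \<ge> k - int n"
      by force
    moreover have "Min (active_sites \<psi>) \<le> m" "m \<le> Max (active_sites \<psi>)"
      using finite_active_sites[OF \<psi>] m(1) by auto
    ultimately show ?thesis by linarith
  qed
  have "Min (active_sites ?\<psi>) \<in> active_sites ?\<psi>" "Max (active_sites ?\<psi>) \<in> active_sites ?\<psi>"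
    using finite_active_sites[OF \<psi>'] active_sites_nonempty[OF nt'] by auto
  from this[THEN bounds] show ?thesis
    unfolding char_diam_def char_support_eq_active_sites[OF \<psi>] char_support_eq_active_sites[OF \<psi>']
    by linarith
qed

lemma char_diam_nonneg:
  fixes \<psi> :: "(int \<Rightarrow> 'a::{topological_space, ab_group_add}) \<Rightarrow> complex"
  assumes nt: "is_nontrivial_character \<psi>"
  shows "char_diam \<psi> \<ge> 0"
proof -
  have \<psi>: "is_character \<psi>" using nt by (simp add: is_nontrivial_character_def)
  show ?thesis
    using finite_active_sites[OF \<psi>] active_sites_nonempty[OF nt] Max_in
    by (simp add: char_diam_def char_support_eq_active_sites[OF \<psi>])
qed

text \<open>
  The scale is the least power of \<open>p\<close> that is at least the diameter, so it divides every other such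
  power.
\<close>

lemma char_scale_dvd:
  fixes \<psi> :: "(int \<Rightarrow> 'a::{topological_space, ab_group_add}) \<Rightarrow> complex"
  assumes nt: "is_nontrivial_character \<psi>" and p: "p > 1" and le: "char_diam \<psi> \<le> int (p ^ n)"
  shows "char_scale p \<psi> dvd p ^ n"
proof (cases "char_diam \<psi> = 0")
  case False
  hence pos: "char_diam \<psi> > 0" using char_diam_nonneg[OF nt] by simp
  have "real_of_int (char_diam \<psi>) \<le> real p ^ n"
    using le by (metis of_int_le_iff of_int_of_nat_eq of_nat_power)
  hence "log (real p) (real_of_int (char_diam \<psi>)) \<le> real n"
    using pos p by (subst log_le_iff) (simp_all add: powr_realpow)
  hence "nat \<lceil>log (real p) (real_of_int (char_diam \<psi>))\<rceil> \<le> n"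
    by (simp add: ceiling_le_iff nat_le_iff)
  thus ?thesis using False by (simp add: char_scale_def le_imp_power_dvd)
qed (simp add: char_scale_def)

lemma char_scale_pos: "p > 0 \<Longrightarrow> char_scale p \<psi> > 0"
  by (simp add: char_scale_def)

section \<open>Invariance of the uniform Bernoulli measure\<close>

lemma prob_space_uniform_bernoulli:
  "prob_space (uniform_bernoulli :: (int \<Rightarrow> 'a::finite) measure)"
  unfolding uniform_bernoulli_def
  by (intro prob_space_PiM prob_space_uniform_count_measure) auto

lemma space_uniform_bernoulli: "space (uniform_bernoulli :: (int \<Rightarrow> 'a::finite) measure) = UNIV"
  by (simp add: uniform_bernoulli_def space_PiM space_uniform_count_measure)

lemma measurable_site_uniform_bernoulli:
  fixes g :: "'a::finite \<Rightarrow> 'b"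
  assumes "g \<in> UNIV \<rightarrow> space N"
  shows "(\<lambda>a. g (a k)) \<in> measurable uniform_bernoulli N"
proof -
  have "(\<lambda>a. a k) \<in> measurable uniform_bernoulli (uniform_count_measure (UNIV :: 'a set))"
    unfolding uniform_bernoulli_def by (rule measurable_component_singleton) simp
  moreover have "g \<in> measurable (uniform_count_measure UNIV) N"
    using assms by (simp add: measurable_def space_uniform_count_measure sets_uniform_count_measure)
  ultimately show ?thesis by (rule measurable_compose)
qed

lemma measurable_translation_uniform_bernoulli:
  fixes x :: "int \<Rightarrow> 'a::{finite, ab_group_add}"
  shows "(\<lambda>a. a + x) \<in> measurable uniform_bernoulli uniform_bernoulli"
proof -
  have "(\<lambda>a. (a + x) k) \<in> measurable uniform_bernoulli (uniform_count_measure UNIV)" for k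
    using measurable_site_uniform_bernoulli[of "\<lambda>u. u + x k" "uniform_count_measure UNIV" k]
    by (simp add: space_uniform_count_measure)
  thus ?thesis
    unfolding uniform_bernoulli_def
    by (intro measurable_PiM_single') (auto simp: space_uniform_count_measure)
qed

text \<open>
  Cylinder sets determine the measure, and a translation permutes the letters at each site, which
  preserves the counting measure of the letters allowed there.
\<close>

lemma uniform_bernoulli_translation_invariant:
  fixes x :: "int \<Rightarrow> 'a::{finite, ab_group_add}"
  shows "distr uniform_bernoulli uniform_bernoulli (\<lambda>a. a + x) = uniform_bernoulli"
proof -
  let ?U = "\<lambda>_::int. uniform_count_measure (UNIV :: 'a set)"
  let ?H = "uniform_bernoulli :: (int \<Rightarrow> 'a) measure"
  interpret H: prob_space ?H by (rule prob_space_uniform_bernoulli)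
  interpret U: product_prob_space ?U UNIV
    by (intro product_prob_spaceI prob_space_uniform_count_measure) auto
  have H: "?H = PiM UNIV ?U" by (simp add: uniform_bernoulli_def)
  have "?H = distr ?H ?H (\<lambda>a. a + x)"
  proof (rule measure_eqI_PiM_infinite[where I = UNIV and M = ?U])
    show "finite_measure ?H" by (rule H.finite_measure_axioms)
  next
    fix A :: "int \<Rightarrow> 'a set" and J :: "int set"
    assume J: "finite J"
    let ?A = "\<lambda>k. {u. u + x k \<in> A k}"
    have emb: "prod_emb UNIV ?U J (PiE J A) \<in> sets ?H" for A
      unfolding H using J by (intro sets_PiM_I) (auto simp: sets_uniform_count_measure)
    have "emeasure (distr ?H ?H (\<lambda>a. a + x)) (prod_emb UNIV ?U J (PiE J A)) =
        emeasure ?H ((\<lambda>a. a + x) -` prod_emb UNIV ?U J (PiE J A) \<inter> space ?H)"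
      by (rule emeasure_distr[OF measurable_translation_uniform_bernoulli emb])
    also have "(\<lambda>a. a + x) -` prod_emb UNIV ?U J (PiE J A) \<inter> space ?H = prod_emb UNIV ?U J (PiE J ?A)"
      by (auto simp: prod_emb_def space_uniform_bernoulli space_uniform_count_measure PiE_iff)
    also have "emeasure ?H \<dots> = (\<Prod>k\<in>J. emeasure (?U k) (?A k))"
      unfolding H using J by (intro U.emeasure_PiM_emb) (auto simp: sets_uniform_count_measure)
    also have "\<dots> = (\<Prod>k\<in>J. emeasure (?U k) (A k))"
    proof (rule prod.cong)
      fix k
      have "(\<lambda>u. u + x k) ` ?A k = A k"
      proof (intro equalityI subsetI)
        fix v assume "v \<in> A k"
        thus "v \<in> (\<lambda>u. u + x k) ` ?A k" by (intro image_eqI[of _ _ "v - x k"]) simp_all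
      qed auto
      hence "card (?A k) = card (A k)"
        using card_image[of "\<lambda>u. u + x k" "?A k"] by (simp add: inj_on_def)
      thus "emeasure (?U k) (?A k) = emeasure (?U k) (A k)"
        by (simp add: emeasure_uniform_count_measure)
    qed simp
    also have "\<dots> = emeasure ?H (prod_emb UNIV ?U J (PiE J A))"
      unfolding H using J by (intro U.emeasure_PiM_emb[symmetric]) (auto simp: sets_uniform_count_measure)
    finally show "emeasure ?H (prod_emb UNIV ?U J (PiE J A)) =
        emeasure (distr ?H ?H (\<lambda>a. a + x)) (prod_emb UNIV ?U J (PiE J A))" ..
  qed (simp_all add: H)
  thus ?thesis by simp
qed

lemma measurable_character_uniform_bernoulli:
  fixes \<psi> :: "(int \<Rightarrow> 'a::{finite, topological_space, ab_group_add}) \<Rightarrow> complex"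
  assumes "is_character \<psi>"
  shows "\<psi> \<in> borel_measurable uniform_bernoulli"
proof -
  have "(\<lambda>a. \<Prod>k\<in>active_sites \<psi>. \<psi> (site_config k (a k))) \<in> borel_measurable uniform_bernoulli"
    by (intro borel_measurable_prod measurable_site_uniform_bernoulli) simp
  thus ?thesis by (simp flip: character_factorization[OF assms])
qed

text \<open>
  Translating by \<open>x\<close> multiplies the integral by \<open>\<psi> x\<close> and, by invariance, leaves it unchanged; choose \<open>x\<close>
  with \<open>\<psi> x \<noteq> 1\<close>.
\<close>

lemma integral_nontrivial_character_uniform_bernoulli:
  fixes \<psi> :: "(int \<Rightarrow> 'a::{finite, topological_space, ab_group_add}) \<Rightarrow> complex"
  assumes "is_nontrivial_character \<psi>"
  shows "integral\<^sup>L uniform_bernoulli \<psi> = 0"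
proof -
  let ?H = "uniform_bernoulli :: (int \<Rightarrow> 'a) measure"
  have \<psi>: "is_character \<psi>" using assms by (simp add: is_nontrivial_character_def)
  obtain x where x: "\<psi> x \<noteq> 1" using assms unfolding is_nontrivial_character_def by blast
  have inv: "distr ?H ?H (\<lambda>a. a + x) = ?H" by (rule uniform_bernoulli_translation_invariant)
  have "integral\<^sup>L ?H \<psi> = integral\<^sup>L (distr ?H ?H (\<lambda>a. a + x)) \<psi>" by (simp only: inv)
  also have "\<dots> = (\<integral>a. \<psi> (a + x) \<partial>?H)"
    by (rule integral_distr[OF measurable_translation_uniform_bernoulli measurable_character_uniform_bernoulli[OF \<psi>]])
  also have "\<dots> = integral\<^sup>L ?H \<psi> * \<psi> x"
    unfolding character_add[OF \<psi>] by (rule integral_mult_left_zero)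
  finally have "integral\<^sup>L ?H \<psi> * (1 - \<psi> x) = 0" by (simp add: algebra_simps)
  thus ?thesis using x by simp
qed

section \<open>Uniform approximation by characters\<close>

text \<open>
  The character \<open>v \<mapsto> exp (2 \<pi> i n v / p)\<close> applied to the coordinate \<open>s\<close> of the letter at site \<open>k\<close>.
  Finite products of these are coded by lists: this family is visibly countable, closed under products
  and conjugation, and separates points. The integer \<open>n\<close> is there for conjugation.
\<close>

definition coord_char :: "int \<times> 's \<times> int \<Rightarrow> (int \<Rightarrow> 'p::prime_card mod_ring ^ 's) \<Rightarrow> complex" where
  "coord_char = (\<lambda>(k, s, n) a.
     cis (2 * pi * (real_of_int n * real_of_int (to_int_mod_ring (a k $ s)) / real CARD('p))))"

definition char_word :: "(int \<times> 's \<times> int) list \<Rightarrow> (int \<Rightarrow> 'p::prime_card mod_ring ^ 's) \<Rightarrow> complex" where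
  "char_word w a = (\<Prod>t\<leftarrow>w. coord_char t a)"

lemma cis_2pi_int: "cis (2 * pi * real_of_int n) = 1"
  using cis_multiple_2pi[of "real_of_int n"] by simp

lemma is_character_coord_char:
  "is_character (coord_char t :: (int \<Rightarrow> 'p::prime_card mod_ring ^ 's::finite) \<Rightarrow> complex)"
proof -
  obtain k s n where t: "t = (k, s, n)" by (cases t)
  let ?e = "\<lambda>a :: int \<Rightarrow> 'p mod_ring ^ 's. coord_char (k, s, n) a"
  let ?h = "\<lambda>v :: 'p mod_ring ^ 's.
    cis (2 * pi * (real_of_int n * real_of_int (to_int_mod_ring (v $ s)) / real CARD('p)))"
  have "continuous_on UNIV (\<lambda>a. ?h (a k))"
    by (rule continuous_on_discrete_binary[where h = "\<lambda>v _. ?h v" and g = "\<lambda>a. a k"]) simp_all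
  hence "continuous_on UNIV ?e" by (simp add: coord_char_def)
  moreover have "?e (a + b) = ?e a * ?e b" for a b
  proof -
    let ?x = "to_int_mod_ring (a k $ s)" and ?y = "to_int_mod_ring (b k $ s)"
    \<comment> \<open>Adding residues loses a multiple of p, which contributes a full number of turns.\<close>
    let ?c = "(?x + ?y) div int CARD('p)"
    have "to_int_mod_ring ((a + b) k $ s) = ?x + ?y - int CARD('p) * ?c"
      by (simp add: to_int_mod_ring_add minus_mult_div_eq_mod)
    hence "real_of_int (to_int_mod_ring ((a + b) k $ s)) =
        real_of_int ?x + real_of_int ?y - real CARD('p) * real_of_int ?c"
      by (simp only: of_int_add of_int_diff of_int_mult of_int_of_nat_eq)
    hence "real_of_int n * real_of_int (to_int_mod_ring ((a + b) k $ s)) / real CARD('p) =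
        real_of_int n * real_of_int ?x / real CARD('p) +
        real_of_int n * real_of_int ?y / real CARD('p) - real_of_int (n * ?c)"
      by (simp add: add_divide_distrib diff_divide_distrib distrib_left right_diff_distrib)
    hence "2 * pi * (real_of_int n * real_of_int (to_int_mod_ring ((a + b) k $ s)) / real CARD('p)) =
        2 * pi * (real_of_int n * real_of_int ?x / real CARD('p)) +
        2 * pi * (real_of_int n * real_of_int ?y / real CARD('p)) + 2 * pi * real_of_int (- (n * ?c))"
      by (simp only: distrib_left right_diff_distrib of_int_minus mult_minus_right add_uminus_conv_diff)
    hence "?e (a + b) = ?e a * ?e b * cis (2 * pi * real_of_int (- (n * ?c)))"
      by (simp only: coord_char_def prod.case cis_mult)
    thus ?thesis unfolding cis_2pi_int by simp
  qed
  ultimately show ?thesis unfolding is_character_def t by (simp add: coord_char_def)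
qed

lemma is_character_char_word:
  "is_character (char_word w :: (int \<Rightarrow> 'p::prime_card mod_ring ^ 's::finite) \<Rightarrow> complex)"
proof (induction w)
  case Nil
  show ?case by (simp add: is_character_def char_word_def)
next
  case (Cons t w)
  have "char_word (t # w) = (\<lambda>a :: int \<Rightarrow> 'p mod_ring ^ 's. coord_char t a * char_word w a)"
    by (simp add: char_word_def fun_eq_iff)
  thus ?case
    using Cons is_character_coord_char[of t, where 'p = 'p]
    by (auto simp: is_character_def norm_mult intro!: continuous_on_mult)
qed

lemma char_word_append: "char_word (v @ w) a = char_word v a * char_word w a"
  by (simp add: char_word_def)

lemma cnj_char_word: "cnj (char_word w a) = char_word (map (\<lambda>(k, s, n). (k, s, - n)) w) a"
  by (induction w) (auto simp: char_word_def coord_char_def cis_cnj)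

lemma char_word_separates:
  fixes x y :: "int \<Rightarrow> 'p::prime_card mod_ring ^ 's::finite"
  assumes "x \<noteq> y"
  obtains w where "char_word w x \<noteq> char_word w y"
proof -
  obtain k s where ks: "x k $ s \<noteq> y k $ s" using assms by (auto simp: fun_eq_iff vec_eq_iff)
  let ?p = "real CARD('p)" and ?u = "to_int_mod_ring (x k $ s)" and ?v = "to_int_mod_ring (y k $ s)"
  have range: "0 \<le> to_int_mod_ring z" "to_int_mod_ring z < int CARD('p)" for z :: "'p mod_ring"
    using range_to_int_mod_ring[where 'a = 'p] by (auto simp: set_eq_iff)
  have "char_word [(k, s, 1)] x \<noteq> char_word [(k, s, 1)] y"
  proof
    assume "char_word [(k, s, 1)] x = char_word [(k, s, 1)] y"
    hence "cis (2 * pi * (real_of_int ?u / ?p)) = cis (2 * pi * (real_of_int ?v / ?p))"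
      by (simp add: char_word_def coord_char_def)
    then obtain m :: int where "2 * pi * (real_of_int ?u / ?p) = 2 * pi * (real_of_int ?v / ?p) + 2 * pi * of_int m"
      by (metis sin_cos_eq_iff cis.sel)
    hence "2 * pi * (real_of_int ?u / ?p) = 2 * pi * (real_of_int ?v / ?p + of_int m)"
      by (simp add: algebra_simps)
    hence "real_of_int ?u / ?p = real_of_int ?v / ?p + of_int m"
      by (rule mult_left_cancel[THEN iffD1, rotated]) simp
    hence "real_of_int ?u = real_of_int (?v + m * int CARD('p))" by (simp add: field_simps)
    hence eq: "?u = ?v + m * int CARD('p)" by (simp only: of_int_eq_iff)
    hence "?u mod int CARD('p) = ?v mod int CARD('p)" by simp
    hence "?u = ?v" using range by simp
    thus False using ks by (metis of_int_mod_ring_to_int_mod_ring)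
  qed
  thus ?thesis by (rule that)
qed

text \<open>
  The complex span, defined inductively because it is only ever used for proving statements that are
  linear in the function.
\<close>

inductive_set trig_polys :: "((int \<Rightarrow> 'p::prime_card mod_ring ^ 's::finite) \<Rightarrow> complex) set" where
  word: "char_word w \<in> trig_polys"
| add: "f \<in> trig_polys \<Longrightarrow> g \<in> trig_polys \<Longrightarrow> (\<lambda>a. f a + g a) \<in> trig_polys"
| scale: "f \<in> trig_polys \<Longrightarrow> (\<lambda>a. c * f a) \<in> trig_polys"

lemma trig_polys_mult:
  assumes "f \<in> trig_polys" "g \<in> trig_polys"
  shows "(\<lambda>a. f a * g a) \<in> trig_polys"
  using assms(1)
proof induction
  case (word v)
  show ?case
    using assms(2)
  proof induction
    case (word w)
    show ?case using trig_polys.word[of "v @ w"] by (simp add: char_word_append[abs_def])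
  next
    case (add f g)
    thus ?case using trig_polys.add by (simp add: distrib_left)
  next
    case (scale f c)
    thus ?case using trig_polys.scale[of "\<lambda>a. char_word v a * f a" c] by (simp add: mult.left_commute)
  qed
next
  case (add f g)
  thus ?case using trig_polys.add by (simp add: distrib_right)
next
  case (scale f c)
  thus ?case using trig_polys.scale[of "\<lambda>a. f a * g a" c] by (simp add: mult.assoc)
qed

lemma trig_polys_const: "(\<lambda>_. c) \<in> trig_polys"
  using trig_polys.scale[OF trig_polys.word[of "[]"], of c] by (simp add: char_word_def)

lemma trig_polys_continuous:
  assumes "f \<in> trig_polys"
  shows "continuous_on UNIV f"
  using assms
  by induction (auto intro!: continuous_on_add continuous_on_mult continuous_character[OF is_character_char_word])

lemma trig_polys_separate:
  fixes x y :: "int \<Rightarrow> 'p::prime_card mod_ring ^ 's::finite"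
  assumes "x \<noteq> y"
  shows "\<exists>f :: _ \<Rightarrow> real. (\<lambda>a. complex_of_real (f a)) \<in> trig_polys \<and> f x \<noteq> f y"
proof -
  obtain w where w: "char_word w x \<noteq> char_word w y" using char_word_separates[OF assms] .
  let ?\<psi> = "char_word w :: (int \<Rightarrow> 'p mod_ring ^ 's) \<Rightarrow> complex"
  have cnj: "(\<lambda>a. cnj (?\<psi> a)) \<in> trig_polys"
    unfolding cnj_char_word by (rule trig_polys.word)
  have "(\<lambda>a. 1 / 2 * (?\<psi> a + cnj (?\<psi> a))) \<in> trig_polys"
    by (intro trig_polys.intros cnj)
  moreover have "(\<lambda>a. 1 / 2 * (?\<psi> a + cnj (?\<psi> a))) = (\<lambda>a. complex_of_real (Re (?\<psi> a)))"
    by (simp add: fun_eq_iff complex_add_cnj)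
  ultimately have Re: "(\<lambda>a. complex_of_real (Re (?\<psi> a))) \<in> trig_polys" by simp
  have "(\<lambda>a. - \<i> / 2 * (?\<psi> a + - 1 * cnj (?\<psi> a))) \<in> trig_polys"
    by (intro trig_polys.intros cnj)
  moreover have "(\<lambda>a. - \<i> / 2 * (?\<psi> a + - 1 * cnj (?\<psi> a))) = (\<lambda>a. complex_of_real (Im (?\<psi> a)))"
    by (simp add: fun_eq_iff complex_eq_iff)
  ultimately have Im: "(\<lambda>a. complex_of_real (Im (?\<psi> a))) \<in> trig_polys" by simp
  show ?thesis
  proof (cases "Re (?\<psi> x) = Re (?\<psi> y)")
    case True
    hence "Im (?\<psi> x) \<noteq> Im (?\<psi> y)" using w by (simp add: complex_eq_iff)
    thus ?thesis using Im by (intro exI[of _ "\<lambda>a. Im (?\<psi> a)"]) simp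
  next
    case False
    thus ?thesis using Re by (intro exI[of _ "\<lambda>a. Re (?\<psi> a)"]) simp
  qed
qed

text \<open>
  The real functions in the span form a point-separating algebra on a compact space, so the
  Stone--Weierstrass theorem applies to real and imaginary parts separately.
\<close>

lemma trig_polys_dense:
  fixes f :: "(int \<Rightarrow> 'p::prime_card mod_ring ^ 's::finite) \<Rightarrow> complex"
  assumes f: "continuous_on UNIV f" and e: "e > 0"
  obtains g where "g \<in> trig_polys" "\<And>x. norm (f x - g x) < e"
proof -
  let ?P = "\<lambda>f :: (int \<Rightarrow> 'p mod_ring ^ 's) \<Rightarrow> real. (\<lambda>a. complex_of_real (f a)) \<in> trig_polys"
  have approx: "\<exists>g. ?P g \<and> (\<forall>x\<in>UNIV. \<bar>h x - g x\<bar> < e / 2)" if "continuous_on UNIV h" for h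
  proof (rule Stone_Weierstrass_HOL[OF compact_UNIV_finite_alphabet])
    show "?P (\<lambda>x. c)" for c by (rule trig_polys_const)
    show "continuous_on UNIV f" if "?P f" for f
      using continuous_on_Re[OF trig_polys_continuous[OF that]] by simp
    show "?P (\<lambda>x. f x + g x)" if "?P f \<and> ?P g" for f g
      using that trig_polys.add by force
    show "?P (\<lambda>x. f x * g x)" if "?P f \<and> ?P g" for f g
      using that trig_polys_mult by force
    show "\<exists>f. ?P f \<and> f x \<noteq> f y" if "x \<in> UNIV \<and> y \<in> UNIV \<and> x \<noteq> y" for x y :: "int \<Rightarrow> 'p mod_ring ^ 's"
      using that trig_polys_separate by blast
  qed (use that e in auto)
  obtain u where u: "?P u" "\<And>x. \<bar>Re (f x) - u x\<bar> < e / 2"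
    using approx[OF continuous_on_Re[OF f]] by blast
  obtain v where v: "?P v" "\<And>x. \<bar>Im (f x) - v x\<bar> < e / 2"
    using approx[OF continuous_on_Im[OF f]] by blast
  show ?thesis
  proof (rule that)
    show "(\<lambda>a. complex_of_real (u a) + \<i> * complex_of_real (v a)) \<in> trig_polys"
      using u(1) v(1) by (intro trig_polys.intros)
    show "norm (f x - (complex_of_real (u x) + \<i> * complex_of_real (v x))) < e" for x
    proof -
      have "norm (f x - (complex_of_real (u x) + \<i> * complex_of_real (v x))) \<le>
          \<bar>Re (f x) - u x\<bar> + \<bar>Im (f x) - v x\<bar>"
        using cmod_le[of "f x - (complex_of_real (u x) + \<i> * complex_of_real (v x))"] by simp
      thus ?thesis using u(2)[of x] v(2)[of x] by simp
    qed
  qed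
qed

text \<open>
  The uniform Bernoulli measure lives on the product sigma-algebra, whereas \<open>f\<close> is only known to be
  continuous, hence Borel. A character depends on finitely many sites and so is measurable for the
  product, and this passes to uniform limits of trigonometric polynomials.
\<close>

lemma continuous_measurable_uniform_bernoulli:
  fixes f :: "(int \<Rightarrow> 'p::prime_card mod_ring ^ 's::finite) \<Rightarrow> complex"
  assumes "continuous_on UNIV f"
  shows "f \<in> borel_measurable uniform_bernoulli"
proof -
  have trig: "g \<in> borel_measurable uniform_bernoulli"
    if "g \<in> trig_polys" for g :: "(int \<Rightarrow> 'p mod_ring ^ 's) \<Rightarrow> complex"
    using that
    by induction (auto intro!: borel_measurable_add borel_measurable_times
        measurable_character_uniform_bernoulli[OF is_character_char_word])
  have "\<forall>n. \<exists>g. g \<in> trig_polys \<and> (\<forall>x. norm (f x - g x) < inverse (real (Suc n)))"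
    using trig_polys_dense[OF assms] by (metis positive_imp_inverse_positive of_nat_0_less_iff zero_less_Suc)
  then obtain G where G: "\<And>n. G n \<in> trig_polys" "\<And>n x. norm (f x - G n x) < inverse (real (Suc n))"
    by metis
  show ?thesis
  proof (rule borel_measurable_LIMSEQ_metric)
    show "G n \<in> borel_measurable uniform_bernoulli" for n by (rule trig[OF G(1)])
    show "(\<lambda>n. G n x) \<longlonglongrightarrow> f x" for x
    proof (rule LIM_zero_cancel, rule Lim_null_comparison)
      show "\<forall>\<^sub>F n in sequentially. norm (G n x - f x) \<le> inverse (real (Suc n))"
        using G(2)[of x] by (intro always_eventually) (simp add: norm_minus_commute less_imp_le)
    qed (rule LIMSEQ_inverse_real_of_nat)
  qed
qed

text \<open>
  A countable form of the Weyl criterion: the integral of a nontrivial character against the uniform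
  measure vanishes, convergence extends linearly to the span, and then to all continuous functions
  because integration against a probability measure is a contraction for the uniform norm.
\<close>

lemma weak_star_tendsto_uniform_bernoulli:
  fixes \<nu> :: "'i \<Rightarrow> (int \<Rightarrow> 'p::prime_card mod_ring ^ 's::finite) measure"
  assumes prob: "\<And>i. prob_space (\<nu> i)" and sets: "\<And>i. sets (\<nu> i) = sets borel"
    and words: "\<And>w. is_nontrivial_character (char_word w :: (int \<Rightarrow> 'p mod_ring ^ 's) \<Rightarrow> complex) \<Longrightarrow>
      ((\<lambda>i. integral\<^sup>L (\<nu> i) (char_word w)) \<longlongrightarrow> 0) F"
  shows "weak_star_tendsto \<nu> uniform_bernoulli F"
proof -
  let ?H = "uniform_bernoulli :: (int \<Rightarrow> 'p mod_ring ^ 's) measure"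
  have int: "integrable M f" if "continuous_on UNIV f" "prob_space M" "f \<in> borel_measurable M"
    for M and f :: "(int \<Rightarrow> 'p mod_ring ^ 's) \<Rightarrow> complex"
  proof -
    interpret prob_space M by fact
    have "bounded (range f)"
      using compact_continuous_image[OF that(1) compact_UNIV_finite_alphabet] by (rule compact_imp_bounded)
    then obtain B where "\<And>x. norm (f x) \<le> B" unfolding bounded_iff by blast
    thus ?thesis using that(3) by (intro integrable_const_bound[of _ B]) auto
  qed
  have meas\<nu>: "f \<in> borel_measurable (\<nu> i)"
    if "continuous_on UNIV f" for f :: "(int \<Rightarrow> 'p mod_ring ^ 's) \<Rightarrow> complex" and i
    using borel_measurable_continuous_onI[OF that] by (simp add: measurable_cong_sets[OF sets refl])
  have int\<nu>: "integrable (\<nu> i) f"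
    if "continuous_on UNIV f" for f :: "(int \<Rightarrow> 'p mod_ring ^ 's) \<Rightarrow> complex" and i
    by (rule int[OF that prob meas\<nu>[OF that]])
  have intH: "integrable ?H f"
    if "continuous_on UNIV f" for f :: "(int \<Rightarrow> 'p mod_ring ^ 's) \<Rightarrow> complex"
    by (rule int[OF that prob_space_uniform_bernoulli continuous_measurable_uniform_bernoulli[OF that]])
  have trig: "((\<lambda>i. integral\<^sup>L (\<nu> i) g) \<longlongrightarrow> integral\<^sup>L ?H g) F"
    if "g \<in> trig_polys" for g
    using that
  proof induction
    case (word w)
    show ?case
    proof (cases "is_nontrivial_character (char_word w :: (int \<Rightarrow> 'p mod_ring ^ 's) \<Rightarrow> complex)")
      case True
      thus ?thesis using words[of w] by (simp add: integral_nontrivial_character_uniform_bernoulli)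
    next
      case False
      hence one: "char_word w = (\<lambda>_ :: int \<Rightarrow> 'p mod_ring ^ 's. 1)"
        using is_character_char_word unfolding is_nontrivial_character_def by blast
      have total: "integral\<^sup>L M (\<lambda>_. 1 :: complex) = 1" if "prob_space M" for M :: "(int \<Rightarrow> 'p mod_ring ^ 's) measure"
        using prob_space.prob_space[OF that] by simp
      show ?thesis unfolding one total[OF prob] total[OF prob_space_uniform_bernoulli] by simp
    qed
  next
    case (add f g)
    hence "continuous_on UNIV f" "continuous_on UNIV g" by (auto intro: trig_polys_continuous)
    thus ?case using tendsto_add[OF add.IH] by (simp add: int\<nu> intH)
  next
    case (scale f c)
    thus ?case by (simp add: tendsto_mult_left)
  qed
  have near: "norm (integral\<^sup>L M f - integral\<^sup>L M g) \<le> e"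
    if "prob_space M" "integrable M f" "integrable M g" "\<And>x. norm (f x - g x) < e"
    for M and f g :: "(int \<Rightarrow> 'p mod_ring ^ 's) \<Rightarrow> complex" and e
  proof -
    interpret prob_space M by fact
    have "norm (integral\<^sup>L M f - integral\<^sup>L M g) = norm (\<integral>x. f x - g x \<partial>M)" using that by simp
    also have "\<dots> \<le> (\<integral>x. norm (f x - g x) \<partial>M)" by (rule integral_norm_bound)
    also have "\<dots> \<le> (\<integral>x. e \<partial>M)"
      using that by (intro integral_mono) (auto intro: less_imp_le)
    finally show ?thesis by (simp add: prob_space)
  qed
  show ?thesis
    unfolding weak_star_tendsto_def
  proof (intro allI impI tendstoI)
    fix f :: "(int \<Rightarrow> 'p mod_ring ^ 's) \<Rightarrow> complex" and e :: real
    assume f: "continuous_on UNIV f" and e: "e > 0"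
    obtain g where g: "g \<in> trig_polys" "\<And>x. norm (f x - g x) < e / 3"
      using trig_polys_dense[OF f, of "e / 3"] e by auto
    note gc = trig_polys_continuous[OF g(1)]
    have "\<forall>\<^sub>F i in F. dist (integral\<^sup>L (\<nu> i) g) (integral\<^sup>L ?H g) < e / 3"
      using trig[OF g(1)] e by (intro tendstoD) auto
    thus "\<forall>\<^sub>F i in F. dist (integral\<^sup>L (\<nu> i) f) (integral\<^sup>L ?H f) < e"
    proof eventually_elim
      case (elim i)
      have "dist (integral\<^sup>L (\<nu> i) f) (integral\<^sup>L (\<nu> i) g) \<le> e / 3"
        unfolding dist_norm by (rule near[OF prob int\<nu>[OF f] int\<nu>[OF gc] g(2)])
      moreover have "dist (integral\<^sup>L ?H f) (integral\<^sup>L ?H g) \<le> e / 3"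
        unfolding dist_norm by (rule near[OF prob_space_uniform_bernoulli intH[OF f] intH[OF gc] g(2)])
      ultimately show ?case
        using elim dist_triangle[of "integral\<^sup>L (\<nu> i) f" "integral\<^sup>L ?H f" "integral\<^sup>L (\<nu> i) g"]
          dist_triangle2[of "integral\<^sup>L (\<nu> i) g" "integral\<^sup>L ?H f" "integral\<^sup>L ?H g"] by linarith
    qed
  qed
qed

section \<open>Lucas mixing and asymptotic randomization\<close>

text \<open>
  Fix \<open>q = p\<^sup>n\<close> and write \<open>j = h q + i\<close> with \<open>0 \<le> i < q\<close>, so that
  \<open>\<psi> \<circ> \<Phi>\<^sup>j = (\<psi> \<circ> \<Phi>\<^sup>i) \<circ> \<Phi>\<^sup>h\<^sup>q\<close>. The character \<open>\<psi> \<circ> \<Phi>\<^sup>i\<close> is nontrivial of diameter at most \<open>D + i\<close>, where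
  \<open>D\<close> is the diameter of \<open>\<psi>\<close>. If \<open>D + i \<le> q\<close>, its scale divides \<open>q\<close>, and Lucas mixing of this
  one character makes the level set null within the residue class of \<open>i\<close>. For the remaining residues
  the scale may exceed \<open>q\<close> and nothing is known, but there are at most \<open>D\<close> of them, so
  their density is at most \<open>D / q\<close>; and \<open>n\<close> is arbitrary.
\<close>

lemma lucas_mixing_imp_null_level_sets:
  fixes \<mu> :: "(int \<Rightarrow> ('p::prime_card mod_ring) ^ 's::finite) measure"
  assumes lucas: "lucas_mixing \<mu>" and nt: "is_nontrivial_character \<psi>" and \<delta>: "\<delta> > 0"
  shows "null_density {j. \<delta> \<le> norm (\<integral>a. \<psi> ((one_plus_shift ^^ j) a) \<partial>\<mu>)}"
proof (rule null_density_approx)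
  fix e :: real assume e: "e > 0"
  let ?p = "CARD('p)"
  let ?F = "\<lambda>j. \<integral>a. \<psi> ((one_plus_shift ^^ j) a) \<partial>\<mu>"
  have p: "?p > 1" using prime_card[where 'a = 'p] by (rule prime_gt_1_nat)
  define D where "D = nat (char_diam \<psi>)"
  have D: "char_diam \<psi> = int D" using char_diam_nonneg[OF nt] by (simp add: D_def)
  obtain n where n: "real D / e < real ?p ^ n" using real_arch_pow[of "real ?p"] p by auto
  define q where "q = ?p ^ n"
  have q: "q > 0" "real D \<le> e * real q" using n e p by (simp_all add: q_def field_simps)
  define good where "good = {i. i < q \<and> D + i \<le> q}"
  define bad where "bad = {i. i < q \<and> q < D + i}"
  have good_null: "null_density {j. j mod q = i \<and> \<delta> \<le> norm (?F j)}" if i: "i \<in> good" for i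
  proof -
    let ?\<psi> = "\<lambda>a. \<psi> ((one_plus_shift ^^ i) a)"
    let ?m = "char_scale ?p ?\<psi>"
    have nt': "is_nontrivial_character ?\<psi>" by (rule is_nontrivial_character_iter[OF nt])
    have "int D + int i \<le> int q" using i by (simp add: good_def)
    hence "char_diam ?\<psi> \<le> int (?p ^ n)"
      using char_diam_iter_le[OF nt, of i] D unfolding q_def by linarith
    then obtain c where c: "q = ?m * c"
      using char_scale_dvd[OF nt' p] unfolding q_def by blast
    obtain H where "cesaro_density_one H"
      "((\<lambda>h. \<integral>a. ?\<psi> ((one_plus_shift ^^ (h * ?m)) a) \<partial>\<mu>) \<longlongrightarrow> 0) (sequentially_in H)"
      using lucas nt' unfolding lucas_mixing_def by blast
    from null_density_level_set[OF this \<delta>]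
    have "null_density ((\<lambda>h. h * ?m + i) `
        {h. \<delta> \<le> norm (\<integral>a. ?\<psi> ((one_plus_shift ^^ (h * ?m)) a) \<partial>\<mu>)})"
      using p by (intro null_density_affine_image char_scale_pos) simp_all
    moreover have "{j. j mod q = i \<and> \<delta> \<le> norm (?F j)} \<subseteq> (\<lambda>h. h * ?m + i) `
        {h. \<delta> \<le> norm (\<integral>a. ?\<psi> ((one_plus_shift ^^ (h * ?m)) a) \<partial>\<mu>)}"
    proof
      fix j assume j: "j \<in> {j. j mod q = i \<and> \<delta> \<le> norm (?F j)}"
      \<comment> \<open>These times use only the multiples h of c; the level set is null along all h, hence along these.\<close>
      define h where "h = j div q * c"
      have "j = j div q * q + i" using j div_mult_mod_eq[of j q] by simp
      also have "j div q * q = h * ?m" unfolding h_def by (subst (2) c) (simp only: ac_simps)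
      finally have jh: "j = h * ?m + i" .
      have "(one_plus_shift ^^ j) a = (one_plus_shift ^^ i) ((one_plus_shift ^^ (h * ?m)) a)"
        for a :: "int \<Rightarrow> 'p mod_ring ^ 's"
        unfolding jh by (simp add: add.commute[of _ i] funpow_add)
      hence "?F j = (\<integral>a. ?\<psi> ((one_plus_shift ^^ (h * ?m)) a) \<partial>\<mu>)" by simp
      thus "j \<in> (\<lambda>h. h * ?m + i) `
          {h. \<delta> \<le> norm (\<integral>a. ?\<psi> ((one_plus_shift ^^ (h * ?m)) a) \<partial>\<mu>)}"
        using j jh by auto
    qed
    ultimately show ?thesis by (rule null_density_subset)
  qed
  have sub: "bad \<subseteq> {q + 1 - D..<q}" by (auto simp: bad_def)
  hence bad_fin: "finite bad" by (rule finite_subset) simp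
  have "card bad \<le> card {q + 1 - D..<q}" by (rule card_mono[OF _ sub]) simp
  also have "\<dots> \<le> D" by simp
  finally have card_bad: "card bad \<le> D" .
  have "{j. \<delta> \<le> norm (?F j)} \<subseteq> (\<Union>i\<in>good. {j. j mod q = i \<and> \<delta> \<le> norm (?F j)}) \<union> {j. j mod q \<in> bad}"
    using q(1) by (auto simp: good_def bad_def)
  moreover have "null_density (\<Union>i\<in>good. {j. j mod q = i \<and> \<delta> \<le> norm (?F j)})"
    by (rule null_density_UN[OF _ good_null]) (auto simp: good_def)
  moreover have "real (card ({j. j mod q \<in> bad} \<inter> {0..<N})) \<le> e * real N + real D" for N
  proof -
    have "card ({j. j mod q \<in> bad} \<inter> {0..<N}) \<le> D * (N div q + 1)"
      using card_residues_below_le[OF bad_fin] mult_le_mono1[OF card_bad] by (rule order_trans)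
    hence "real (card ({j. j mod q \<in> bad} \<inter> {0..<N})) \<le> real (D * (N div q + 1))"
      by (simp only: of_nat_le_iff)
    moreover have "real D * real (N div q) \<le> e * real N"
    proof -
      have "real D * real (N div q) \<le> e * real q * real (N div q)"
        using q(2) by (intro mult_right_mono) auto
      also have "\<dots> = e * real (q * (N div q))" by simp
      also have "\<dots> \<le> e * real N"
      proof (rule mult_left_mono)
        have "q * (N div q) \<le> N" by simp
        thus "real (q * (N div q)) \<le> real N" by (simp only: of_nat_le_iff)
      qed (use e in simp)
      finally show ?thesis .
    qed
    ultimately show ?thesis by (simp add: distrib_left)
  qed
  ultimately show "\<exists>Z R C. {j. \<delta> \<le> norm (?F j)} \<subseteq> Z \<union> R \<and> null_density Z \<and>
      (\<forall>N. real (card (R \<inter> {0..<N})) \<le> e * real N + C)"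
    by blast
qed

text \<open>
  From randomization to Lucas mixing, test against a single character and pass to the times in \<open>J\<close> that
  are multiples of its scale. Conversely, one set \<open>J\<close> serves all of the countably many test characters.
\<close>

theorem theorem7p1:
  fixes \<mu> :: "(int \<Rightarrow> ('p::prime_card mod_ring) ^ 's::finite) measure"
  assumes "prob_space \<mu>" and "sets \<mu> = sets borel"
  shows "asymptotically_randomizes one_plus_shift \<mu> \<longleftrightarrow> lucas_mixing \<mu>"
proof
  have meas: "(one_plus_shift ^^ j) \<in> measurable \<mu> borel" for j
    using borel_measurable_continuous_onI[OF continuous_one_plus_shift_iter]
    by (simp add: measurable_cong_sets[OF assms(2) refl])
  have push: "integral\<^sup>L (distr \<mu> borel (one_plus_shift ^^ j)) f = (\<integral>a. f ((one_plus_shift ^^ j) a) \<partial>\<mu>)"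
    if "continuous_on UNIV f" for j and f :: "(int \<Rightarrow> 'p mod_ring ^ 's) \<Rightarrow> complex"
    by (rule integral_distr[OF meas borel_measurable_continuous_onI[OF that]])
  {
    assume "asymptotically_randomizes one_plus_shift \<mu>"
    then obtain J where J: "cesaro_density_one J"
      and conv: "weak_star_tendsto (\<lambda>j. distr \<mu> borel (one_plus_shift ^^ j)) uniform_bernoulli (sequentially_in J)"
      unfolding asymptotically_randomizes_def by blast
    show "lucas_mixing \<mu>"
      unfolding lucas_mixing_def
    proof (intro allI impI)
      fix \<psi> :: "(int \<Rightarrow> 'p mod_ring ^ 's) \<Rightarrow> complex"
      assume nt: "is_nontrivial_character \<psi>"
      hence cont: "continuous_on UNIV \<psi>" by (simp add: is_nontrivial_character_def continuous_character)
      let ?m = "char_scale CARD('p) \<psi>"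
      have m: "?m > 0" by (simp add: char_scale_pos)
      have lim: "((\<lambda>j. \<integral>a. \<psi> ((one_plus_shift ^^ j) a) \<partial>\<mu>) \<longlongrightarrow> 0) (sequentially_in J)"
        using conv cont unfolding weak_star_tendsto_def
        by (auto simp: push integral_nontrivial_character_uniform_bernoulli[OF nt])
      let ?H = "{h. h * ?m \<in> J}"
      have "cesaro_density_one ?H"
        using null_density_multiples[of "- J" ?m] J m
        by (simp add: cesaro_density_one_iff_null_Compl Compl_eq)
      moreover have "filterlim (\<lambda>h. h * ?m) (sequentially_in J) (sequentially_in ?H)"
        unfolding filterlim_iff
      proof (intro allI impI)
        fix P assume "eventually P (sequentially_in J)"
        hence ev: "\<forall>\<^sub>F j in sequentially. j \<in> J \<longrightarrow> P j" by (simp only: eventually_sequentially_in)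
        have "filterlim (\<lambda>h. h * ?m) sequentially sequentially"
          using m by (intro filterlim_subseq) (auto simp: strict_mono_def)
        from eventually_compose_filterlim[OF ev this]
        show "\<forall>\<^sub>F h in sequentially_in ?H. P (h * ?m)" by (simp add: eventually_sequentially_in)
      qed
      from filterlim_compose[OF lim this]
      have "((\<lambda>h. \<integral>a. \<psi> ((one_plus_shift ^^ (h * ?m)) a) \<partial>\<mu>) \<longlongrightarrow> 0) (sequentially_in ?H)" .
      ultimately show "\<exists>H. cesaro_density_one H \<and>
          ((\<lambda>h. \<integral>a. \<psi> ((one_plus_shift ^^ (h * ?m)) a) \<partial>\<mu>) \<longlongrightarrow> 0) (sequentially_in H)" by blast
    qed
  next
    assume lucas: "lucas_mixing \<mu>"
    let ?W = "{w :: (int \<times> 's \<times> int) list.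
      is_nontrivial_character (char_word w :: (int \<Rightarrow> 'p mod_ring ^ 's) \<Rightarrow> complex)}"
    let ?f = "\<lambda>w j. \<integral>a. (char_word w :: (int \<Rightarrow> 'p mod_ring ^ 's) \<Rightarrow> complex) ((one_plus_shift ^^ j) a) \<partial>\<mu>"
    have "countable (UNIV :: (int \<times> 's \<times> int) set)"
      unfolding UNIV_Times_UNIV[symmetric]
      by (intro countable_SIGMA) (simp_all add: countable_finite)
    hence "countable (lists (UNIV :: (int \<times> 's \<times> int) set))" by (rule countable_lists)
    hence cnt: "countable ?W" by (rule countable_subset[rotated]) simp
    have null: "null_density {j. \<delta> \<le> norm (?f w j)}" if "w \<in> ?W" "\<delta> > 0" for w \<delta>
      using that lucas by (intro lucas_mixing_imp_null_level_sets) auto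
    obtain J where J: "cesaro_density_one J"
      and lim: "\<And>w. w \<in> ?W \<Longrightarrow> (?f w \<longlongrightarrow> 0) (sequentially_in J)"
      using common_density_one_set[where I = ?W and f = ?f, OF cnt null] by blast
    have "weak_star_tendsto (\<lambda>j. distr \<mu> borel (one_plus_shift ^^ j)) uniform_bernoulli (sequentially_in J)"
    proof (rule weak_star_tendsto_uniform_bernoulli)
      show "prob_space (distr \<mu> borel (one_plus_shift ^^ j))" for j
        by (rule prob_space.prob_space_distr[OF assms(1) meas])
      show "((\<lambda>j. integral\<^sup>L (distr \<mu> borel (one_plus_shift ^^ j)) (char_word w)) \<longlongrightarrow> 0) (sequentially_in J)"
        if "is_nontrivial_character (char_word w :: (int \<Rightarrow> 'p mod_ring ^ 's) \<Rightarrow> complex)" for w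
        using lim[of w] that by (simp add: push continuous_character is_character_char_word)
    qed simp
    with J show "asymptotically_randomizes one_plus_shift \<mu>"
      unfolding asymptotically_randomizes_def by blast
  }
qed

end
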